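(* Let $X$ be a geometrically integral projective scheme over a number field $K$. Let $V$ be a vector subspace of $\widehat{\mathrm{Div}}_{\mathbb R}(X)$ containing all principal adelic arithmetic $\mathbb R$-Cartier divisors $\widehat{(\phi)}$, $\phi\in\mathrm{Rat}(X)^\times_{\mathbb R}$, and let $V_+$ be the set of effective elements of $V$. Let $C_\circ\subseteq V$ be a subset such that: (a) $\lambda\overline D\in C_\circ$ for all $\overline D\in C_\circ$ and $\lambda>0$; (b) for all $\overline D_0\in C_\circ$ and $\overline D\in V_+$ there is $\varepsilon_0>0$ such that $\overline D_0+\varepsilon\overline D\in C_\circ$ for all real $\varepsilon$ with $0\le\varepsilon\le\varepsilon_0$; (c) $\overline D+\widehat{(\phi)}\in C_\circ$ for all $\overline D\in C_\circ$ and $\phi\in\mathrm{Rat}(X)^\times_{\mathbb R}$. Let $\mu:C_\circ\to\mathbb R$ be a map such that: (1) there is $a>0$ with $\mu(t\overline D)=t^a\mu(\overline D)$ for all $\overline D\in C_\circ$ and $t>0$; (2) $\mu(\overline D+\widehat{(\phi)})=\mu(\overline D)$ for all $\overline D\in C_\circ$ and $\phi\in\mathrm{Rat}(X)^\times_{\mathbb R}$; (3) there is given a map $\nabla_\mu:\widehat{\mathrm{Div}}_{\mathbb R}(X)_+\times C_\circ\to\mathbb R\cup\{\pm\infty\}$, where $\widehat{\mathrm{Div}}_{\mathbb R}(X)_+$ is the set of effective elements of $\widehat{\mathrm{Div}}_{\mathbb R}(X)$, such that for $\overline E\in V_+$ and $\overline D\in C_\circ$ $$\nabla_\mu(\overline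 E,\overline D)=\nabla^+_{\overline E}\mu(\overline D):=\limsup_{\epsilon\to0+}\frac{\mu(\overline D+\epsilon\overline E)-\mu(\overline D)}{\epsilon}.$$ Let $C_{\circ\circ}$ be the set of $\overline D\in C_\circ$ such that $\nabla_\mu(\overline E_1,\overline D)\le\nabla_\mu(\overline E_2,\overline D)$ whenever $\overline E_1,\overline E_2\in\widehat{\mathrm{Div}}_{\mathbb R}(X)_+$ and $\overline E_1\le\overline E_2$. For $\overline D\in C_{\circ\circ}$ and $v\in M_K\cup K(\mathbb C)$ define $\Psi^\mu_{\overline D,v}:C^0(X_v^{\mathrm{an}})_+\to[0,+\infty]$ on non-negative continuous functions by $\Psi^\mu_{\overline D,v}(f_v)=\nabla_\mu(\overline O(f_v),\overline D)$, and let $\mathrm{Supp}(\Psi^\mu_{\overline D,v})$ be the set of $x\in X_v^{\mathrm{an}}$ such that $\Psi^\mu_{\overline D,v}(f_v)>0$ for every non-negative continuous $f_v$ on $X_v^{\mathrm{an}}$ with $f_v(x)>0$. Let $\overline D=(D,g)\in C_{\circ\circ}$ with $\mu(\overline D)=0$. If $s\in\mathrm{Rat}(X)^\times_{\mathbb R}$ satisfies $\overline D+\widehat{(s)}\ge0$, then $$\mathrm{Supp}(\Psi^\mu_{\overline D,v})\cap\{x\in X_v^{\mathrm{an}}: |s|_{g_v}(x)<1\}=\varnothing$$ for every $v\in M_K\cup K(\mathbb C)$.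
   Context: Notation: $O_K$ is the ring of integers of $K$, $M_K$ the set of its maximal ideals, $K(\mathbb C)$ the set of embeddings $K\hookrightarrow\mathbb C$. For $v=\mathfrak p\in M_K$, $K_v$ is the completion of $K$ at $\mathfrak p$ with $|a|_{\mathfrak p}=\#(O_K/\mathfrak p)^{-\mathrm{ord}_{\mathfrak p}(a)}$; for $v=\sigma\in K(\mathbb C)$, $K_v=K\otimes^{\sigma}_K\mathbb C\cong\mathbb C$. $X_v=X\times_{\mathrm{Spec} K}\mathrm{Spec} K_v$; $X_v^{\mathrm{an}}$ is $X_\sigma(\mathbb C)$ with the analytic topology if $v=\sigma$, and the Berkovich analytification if $v=\mathfrak p$. $X(\mathbb C)=\coprod_\sigma X_\sigma(\mathbb C)$; complex conjugation induces an involution $F_\infty$ of $X(\mathbb C)$ (exchanging $X_\sigma(\mathbb C)$ and $X_{\bar\sigma}(\mathbb C)$). $\mathrm{Div}_{\mathbb R}(X)=\mathrm{Div}(X)\otimes_{\mathbb Z}\mathbb R$ ($\mathrm{Div}(X)$ = Cartier divisors), $\mathrm{Rat}(X)^\times_{\mathbb R}=\mathrm{Rat}(X)^\times\otimes_{\mathbb Z}\mathbb R$, and $\varphi\mapsto(\varphi)$ is extended $\mathbb R$-linearly. $D\ge 0$ means that $D$ is a combination of effective Cartier divisors with non-negative real coefficients. A $D$-Green function of $C^0$-type on $X_v^{\mathrm{an}}$ is a real function $g_v$ defined off $\mathrm{Supp}(D)$ such that, for every local equation $\phi$ of $D$, $g_v+\log|\phi|^2$ extends to a continuous function locally. If $\mathscr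 X$ is a model of $X$ (projective flat integral scheme with generic fibre $X$) over a non-empty open $U\subseteq\mathrm{Spec}(O_K)$ and $\mathscr D$ an $\mathbb R$-Cartier divisor on $\mathscr X$ restricting to $D$, the model Green function at $\mathfrak p\in U$ is $x\mapsto-\log|\phi|_x^2$, with $\phi$ a local equation of $\mathscr D$ at the reduction of $x$. An adelic arithmetic $\mathbb R$-Cartier divisor (of $C^0$-type) is a pair $\overline D=(D,g)$, $g=(g_v)_{v\in M_K\cup K(\mathbb C)}$, also written $g=\sum_vg_v[v]$, with $g_v$ a $D$-Green function of $C^0$-type on $X_v^{\mathrm{an}}$, such that for all but finitely many $\mathfrak p$ the $g_{\mathfrak p}$ come from one model $(\mathscr X,\mathscr D)$ over some $U$, and $(g_\sigma)_\sigma$ is $F_\infty$-invariant. They form the real vector space $\widehat{\mathrm{Div}}_{\mathbb R}(X)$. $\overline D\ge0$ (effective) means $D\ge0$ and $g_v\ge0$ for all $v$; $\overline E_1\le\overline E_2$ means $\overline E_2-\overline E_1\ge0$. For $\phi\in\mathrm{Rat}(X)^\times_{\mathbb R}$, $\widehat{(\phi)}=((\phi),(-\log|\phi|_v^2)_v)$. If $D+(s)\ge0$, $|s|_{g_v}:=|s|_v\exp(-g_v/2)$, a continuous function on $X_v^{\mathrm{an}}$. For $f_v\in C^0(X_v^{\mathrm{an}})$, $\overline O(f_v)\in\widehat{\mathrm{Div}}_{\mathbb R}(X)$ is $(0,f_v[v])$ if $v\in M_K$ and $(0,\frac12f_v[v]+\frac12F_\infty^*(f_v)[\bar v])$ if $v\in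 K(\mathbb C)$. *)

theory Defs
  imports
    "HOL-Analysis.Analysis"
    "HOL-Algebra.Algebra"
    "HOL-Algebra.Algebraic_Closure_Type"
    "HOL-Library.Poly_Mapping"
    "HOL-Library.Function_Algebras"
    "HOL-Computational_Algebra.Polynomial"
begin

section \<open>Number fields and their places\<close>

abbreviation field_ring :: "'a::field ring" where
  "field_ring \<equiv> ring_of_type_algebra"

abbreviation ring_on :: "'a::field set \<Rightarrow> 'a ring" where
  "ring_on S \<equiv> field_ring\<lparr>carrier := S\<rparr>"

definition number_field :: "'k::field_char_0 itself \<Rightarrow> bool" where
  "number_field _ \<longleftrightarrow>
     (\<exists>B::'k set. finite B \<and> (\<forall>x. \<exists>c::'k \<Rightarrow> rat. x = (\<Sum>b\<in>B. of_rat (c b) * b)))"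

definition OK :: "'k::field_char_0 set" where
  "OK = {x. algebraic_int x}"

definition MK :: "'k::field_char_0 set set" where
  "MK = {p. maximalideal p (ring_on OK)}"

primrec ideal_power :: "('a, 'b) ring_scheme \<Rightarrow> 'a set \<Rightarrow> nat \<Rightarrow> 'a set" where
  "ideal_power R I 0 = carrier R"
| "ideal_power R I (Suc n) = ideal_prod R I (ideal_power R I n)"

definition ord_OK :: "'k::field_char_0 set \<Rightarrow> 'k \<Rightarrow> nat" where
  "ord_OK p b = (GREATEST n. b \<in> ideal_power (ring_on OK) p n)"

definition ord_at :: "'k::field_char_0 set \<Rightarrow> 'k \<Rightarrow> int" where
  "ord_at p a = (THE k. \<exists>b\<in>OK - {0}. \<exists>c\<in>OK - {0}.
      a = b / c \<and> k = int (ord_OK p b) - int (ord_OK p c))"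

definition abs_at :: "'k::field_char_0 set \<Rightarrow> 'k \<Rightarrow> real" where
  "abs_at p a = (if a = 0 then 0
     else real (card (carrier (ring_on OK Quot p))) powi (- ord_at p a))"

text \<open>The completion of \<open>K\<close> at \<open>p\<close> is the ring of Cauchy sequences modulo the null
  sequences; \<open>completion_abs\<close> is the absolute value of the class of a Cauchy sequence.\<close>

definition cauchy_seqs :: "'k::field_char_0 set \<Rightarrow> (nat \<Rightarrow> 'k) set" where
  "cauchy_seqs p = {c. \<forall>e>0. \<exists>N. \<forall>m\<ge>N. \<forall>n\<ge>N. abs_at p (c m - c n) < e}"

definition completion_abs :: "'k::field_char_0 set \<Rightarrow> (nat \<Rightarrow> 'k) \<Rightarrow> real" where
  "completion_abs p c = lim (\<lambda>n. abs_at p (c n))"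

datatype 'k place = Fin "'k set" | Emb "'k \<Rightarrow> complex"

definition embeddings :: "('k::field_char_0 \<Rightarrow> complex) set" where
  "embeddings = ring_hom field_ring field_ring"

definition places :: "'k::field_char_0 place set" where
  "places = Fin ` MK \<union> Emb ` embeddings"

fun conj_place :: "'k place \<Rightarrow> 'k place" where
  "conj_place (Fin p) = Fin p"
| "conj_place (Emb \<sigma>) = Emb (cnj \<circ> \<sigma>)"


section \<open>Tensor products of algebras over \<open>K\<close>\<close>

text \<open>For a subring \<open>A\<close> of a \<open>K\<close>-algebra (structure map \<open>i\<close>) and a subring \<open>B\<close> of a
  \<open>K\<close>-algebra (structure map \<open>j\<close>), \<open>A \<otimes>\<^sub>K B\<close> is the monoid ring \<open>\<int>[A \<times> B]\<close> modulo
  the bilinear relations.\<close>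

definition pair_prod ::
  "('a::times \<times> 'b::times \<Rightarrow>\<^sub>0 int) \<Rightarrow> ('a \<times> 'b \<Rightarrow>\<^sub>0 int) \<Rightarrow> ('a \<times> 'b \<Rightarrow>\<^sub>0 int)" where
  "pair_prod z w =
     frag_extend (\<lambda>(a, b). frag_extend (\<lambda>(a', b'). frag_of (a * a', b * b')) w) z"

definition pair_ring :: "'a::ring_1 set \<Rightarrow> 'b::ring_1 set \<Rightarrow> ('a \<times> 'b \<Rightarrow>\<^sub>0 int) ring" where
  "pair_ring A B = \<lparr>carrier = {z. Poly_Mapping.keys z \<subseteq> A \<times> B}, mult = pair_prod,
     one = frag_of (1, 1), ring.zero = 0, add = (+)\<rparr>"

definition tensor_relations ::
  "('k \<Rightarrow> 'a::ring_1) \<Rightarrow> ('k \<Rightarrow> 'b::ring_1) \<Rightarrow> 'a set \<Rightarrow> 'b set \<Rightarrow> ('a \<times> 'b \<Rightarrow>\<^sub>0 int) set" where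
  "tensor_relations i j A B =
     {frag_of (a + a', b) - frag_of (a, b) - frag_of (a', b) | a a' b. a \<in> A \<and> a' \<in> A \<and> b \<in> B}
   \<union> {frag_of (a, b + b') - frag_of (a, b) - frag_of (a, b') | a b b'. a \<in> A \<and> b \<in> B \<and> b' \<in> B}
   \<union> {frag_of (i k * a, b) - frag_of (a, j k * b) | k a b. a \<in> A \<and> b \<in> B}"

definition tensor_ring ::
  "('k \<Rightarrow> 'a::ring_1) \<Rightarrow> ('k \<Rightarrow> 'b::ring_1) \<Rightarrow> 'a set \<Rightarrow> 'b set \<Rightarrow> ('a \<times> 'b \<Rightarrow>\<^sub>0 int) set ring" where
  "tensor_ring i j A B =
     pair_ring A B Quot (genideal (pair_ring A B) (tensor_relations i j A B))"


section \<open>Integral schemes as sets of local rings\<close>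

text \<open>An integral separated scheme with function field \<open>F\<close> is identified with the set of its
  local rings, subrings of \<open>F\<close> (Chevalley, Zariski): a point is its local ring, the generic
  point is \<open>F = UNIV\<close> itself, and the Zariski topology is generated by the domains of
  definition of the rational functions.\<close>

definition runits :: "'f::field set \<Rightarrow> 'f set" where
  "runits A = {u \<in> A. u \<noteq> 0 \<and> inverse u \<in> A}"

definition localization :: "'f::field set \<Rightarrow> 'f set \<Rightarrow> 'f set" where
  "localization A P = {a / b | a b. a \<in> A \<and> b \<in> A - P}"

definition affine_points :: "'f::field set \<Rightarrow> 'f set set" where
  "affine_points A = {localization A P | P. primeideal P (ring_on A)}"

text \<open>\<open>Xs\<close> is an integral closed subscheme of a projective space over \<open>R \<subseteq> K\<close>, dominant over
  \<open>Spec R\<close>, with function field \<open>F\<close>. The elements of \<open>S\<close> are the ratios \<open>T\<^sub>j / T\<^sub>0\<close> of the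
  homogeneous coordinates not vanishing identically on \<open>Xs\<close>, and the chart \<open>T\<^sub>i \<noteq> 0\<close> is the
  spectrum of \<open>R[T\<^sub>j / T\<^sub>i]\<close>. For \<open>R\<close> Dedekind such an \<open>Xs\<close> is flat over \<open>R\<close>.\<close>

definition projective_integral ::
  "('k::field \<Rightarrow> 'f::field) \<Rightarrow> 'k set \<Rightarrow> 'f set set \<Rightarrow> bool" where
  "projective_integral \<iota> R Xs \<longleftrightarrow>
     (\<exists>S. finite S \<and> S \<noteq> {} \<and> 0 \<notin> S \<and>
        Xs = (\<Union>x\<in>S. affine_points (generate_ring field_ring (\<iota> ` R \<union> (\<lambda>y. y / x) ` S)))) \<and>
     UNIV \<in> Xs"

text \<open>Geometric integrality: the base change of \<open>Xs\<close> to an algebraic closure \<open>L\<close> of \<open>K\<close> is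
  integral. It is covered by the subschemes \<open>Spec (A \<otimes>\<^sub>K L)\<close>, \<open>A \<in> Xs\<close>, all of which contain
  its fibre over the generic point of \<open>Xs\<close>.\<close>

definition geom_integral_projective ::
  "('k::field \<Rightarrow> 'f::field) \<Rightarrow> 'f set set \<Rightarrow> bool" where
  "geom_integral_projective \<iota> Xs \<longleftrightarrow>
     \<iota> \<in> ring_hom field_ring field_ring \<and> projective_integral \<iota> UNIV Xs \<and>
     (\<forall>A\<in>Xs. domain (tensor_ring \<iota> (to_ac :: 'k \<Rightarrow> 'k alg_closure) A UNIV))"

definition zariski :: "'f set set \<Rightarrow> 'f set topology" where
  "zariski Xs = topology_generated_by (range (\<lambda>f. {A \<in> Xs. f \<in> A}))"


section \<open>Real tensor products of abelian groups\<close>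

text \<open>\<open>G \<otimes>\<^sub>\<int> \<real>\<close> for a commutative group \<open>G\<close>, as the real vector space of formal sums modulo
  the span of \<open>[ab] - [a] - [b]\<close>; the elements are the residue classes.\<close>

definition pscale :: "real \<Rightarrow> ('g \<Rightarrow>\<^sub>0 real) \<Rightarrow> ('g \<Rightarrow>\<^sub>0 real)" where
  "pscale r = Poly_Mapping.map (\<lambda>x. r * x)"

definition formal_sums :: "('g, 'b) monoid_scheme \<Rightarrow> ('g \<Rightarrow>\<^sub>0 real) set" where
  "formal_sums G = {z. Poly_Mapping.keys z \<subseteq> carrier G}"

definition sum_relations :: "('g, 'b) monoid_scheme \<Rightarrow> ('g \<Rightarrow>\<^sub>0 real) set" where
  "sum_relations G = module.span pscale
     {Poly_Mapping.single (a \<otimes>\<^bsub>G\<^esub> b) 1 - Poly_Mapping.single a 1 - Poly_Mapping.single b 1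
      | a b. a \<in> carrier G \<and> b \<in> carrier G}"

definition rclass :: "('g, 'b) monoid_scheme \<Rightarrow> ('g \<Rightarrow>\<^sub>0 real) \<Rightarrow> ('g \<Rightarrow>\<^sub>0 real) set" where
  "rclass G z = {w \<in> formal_sums G. w - z \<in> sum_relations G}"

definition real_tensor :: "('g, 'b) monoid_scheme \<Rightarrow> ('g \<Rightarrow>\<^sub>0 real) set set" where
  "real_tensor G = rclass G ` formal_sums G"

definition rt_add ::
  "('g, 'b) monoid_scheme \<Rightarrow> ('g \<Rightarrow>\<^sub>0 real) set \<Rightarrow> ('g \<Rightarrow>\<^sub>0 real) set \<Rightarrow> ('g \<Rightarrow>\<^sub>0 real) set" where
  "rt_add G c d = (\<Union>z\<in>c. \<Union>w\<in>d. rclass G (z + w))"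

definition rt_scale ::
  "('g, 'b) monoid_scheme \<Rightarrow> real \<Rightarrow> ('g \<Rightarrow>\<^sub>0 real) set \<Rightarrow> ('g \<Rightarrow>\<^sub>0 real) set" where
  "rt_scale G r c = (\<Union>z\<in>c. rclass G (pscale r z))"

definition push :: "('g \<Rightarrow> 'h) \<Rightarrow> ('g \<Rightarrow>\<^sub>0 real) \<Rightarrow> ('h \<Rightarrow>\<^sub>0 real)" where
  "push f z =
     (\<Sum>a\<in>Poly_Mapping.keys z. Poly_Mapping.single (f a) (Poly_Mapping.lookup z a))"

text \<open>The \<open>\<real>\<close>-linear extension of a homomorphism \<open>f\<close> to \<open>H\<close>.\<close>

definition rt_map ::
  "('h, 'b) monoid_scheme \<Rightarrow> ('g \<Rightarrow> 'h) \<Rightarrow> ('g \<Rightarrow>\<^sub>0 real) set \<Rightarrow> ('h \<Rightarrow>\<^sub>0 real) set" where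
  "rt_map H f c = (\<Union>z\<in>c. rclass H (push f z))"


section \<open>Cartier divisors with real coefficients\<close>

type_synonym 'f rrat = "('f \<Rightarrow>\<^sub>0 real) set"
type_synonym 'f cdiv = "'f set \<Rightarrow> 'f set"
type_synonym 'f rdiv = "('f cdiv \<Rightarrow>\<^sub>0 real) set"

definition rat_group :: "'f::field monoid" where
  "rat_group = \<lparr>carrier = UNIV - {0}, mult = (*), one = 1\<rparr>"

abbreviation rat_R :: "'f::field rrat set" where
  "rat_R \<equiv> real_tensor rat_group"

text \<open>Sections over \<open>Xs\<close> of the sheaf \<open>F\<^sup>\<times> / O\<^sup>\<times>\<close>: the value at the point \<open>A\<close> is a coset of \<open>A\<^sup>\<times>\<close>.
  \<open>Xs\<close> may be any set of local rings with its Zariski topology, for instance an open subset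
  of a scheme, a single point or the generic fibre of a model.\<close>

definition principal_cdiv :: "'f::field set set \<Rightarrow> 'f \<Rightarrow> 'f cdiv" where
  "principal_cdiv Xs a = (\<lambda>A. if A \<in> Xs then (\<lambda>u. a * u) ` runits A else {})"

definition cartier :: "'f::field set set \<Rightarrow> 'f cdiv monoid" where
  "cartier Xs =
     \<lparr>carrier = {D. (\<forall>A. A \<notin> Xs \<longrightarrow> D A = {}) \<and>
        (\<forall>A\<in>Xs. \<exists>U a. openin (zariski Xs) U \<and> A \<in> U \<and> a \<noteq> 0 \<and>
           (\<forall>B\<in>U. D B = principal_cdiv Xs a B))},
      mult = (\<lambda>D E A. {a * b | a b. a \<in> D A \<and> b \<in> E A}),
      one = principal_cdiv Xs 1\<rparr>"

abbreviation div_R :: "'f::field set set \<Rightarrow> 'f rdiv set" where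
  "div_R Xs \<equiv> real_tensor (cartier Xs)"

definition principal_rdiv :: "'f::field set set \<Rightarrow> 'f rrat \<Rightarrow> 'f rdiv" where
  "principal_rdiv Xs \<phi> = rt_map (cartier Xs) (principal_cdiv Xs) \<phi>"

definition restrict_rdiv :: "'f::field set set \<Rightarrow> 'f rdiv \<Rightarrow> 'f rdiv" where
  "restrict_rdiv U D = rt_map (cartier U) (\<lambda>E A. if A \<in> U then E A else {}) D"

definition effective_cdiv :: "'f::field set set \<Rightarrow> 'f cdiv \<Rightarrow> bool" where
  "effective_cdiv Xs D \<longleftrightarrow> D \<in> carrier (cartier Xs) \<and> (\<forall>A\<in>Xs. D A \<subseteq> A)"

definition effective_rdiv :: "'f::field set set \<Rightarrow> 'f rdiv \<Rightarrow> bool" where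
  "effective_rdiv Xs D \<longleftrightarrow>
     (\<exists>z. D = rclass (cartier Xs) z \<and>
        (\<forall>E\<in>Poly_Mapping.keys z. effective_cdiv Xs E \<and> Poly_Mapping.lookup z E \<ge> 0))"

definition local_equation :: "'f::field rdiv \<Rightarrow> 'f set set \<Rightarrow> 'f rrat \<Rightarrow> bool" where
  "local_equation D U \<phi> \<longleftrightarrow> \<phi> \<in> rat_R \<and> restrict_rdiv U D = principal_rdiv U \<phi>"

definition Supp :: "'f::field set set \<Rightarrow> 'f rdiv \<Rightarrow> 'f set set" where
  "Supp Xs D = {A \<in> Xs. restrict_rdiv {A} D \<noteq> rclass (cartier {A}) 0}"


section \<open>Analytifications\<close>

text \<open>Points of the analytification carry the local ring \<open>A\<close> of their image in \<open>Xs\<close>. At a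
  finite place, a point of \<open>Xs\<^sub>v\<close> over \<open>A\<close> together with an absolute value on its residue
  field is a multiplicative seminorm on \<open>A \<otimes>\<^sub>K K\<^sub>v\<close> that extends the absolute value of \<open>K\<^sub>v\<close>
  and has kernel in \<open>A\<close> the maximal ideal; it is recorded by its pullback along
  \<open>\<int>[A \<times> C] \<rightarrow> A \<otimes>\<^sub>K K\<^sub>v\<close>, where \<open>C\<close> is the ring of Cauchy sequences. (Null sequences have
  absolute value \<open>0\<close>, so that the pullback is determined by the tensor relations over \<open>C\<close>.)
  At \<open>\<sigma>\<close>, a point of \<open>Xs\<^sub>\<sigma>(\<complex>)\<close> over \<open>A\<close> is a local homomorphism \<open>A \<rightarrow> \<complex>\<close> extending \<open>\<sigma>\<close>.
  All functions are \<open>0\<close> outside their domain.\<close>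

datatype ('k, 'f) point =
    NPoint "'f set" "('f \<times> (nat \<Rightarrow> 'k) \<Rightarrow>\<^sub>0 int) \<Rightarrow> real"
  | CPoint "'f set" "'f \<Rightarrow> complex"

fun local_ring :: "('k, 'f) point \<Rightarrow> 'f set" where
  "local_ring (NPoint A N) = A"
| "local_ring (CPoint A h) = A"

fun pabs :: "('k::field, 'f::field) point \<Rightarrow> 'f \<Rightarrow> real" where
  "pabs (NPoint A N) f = N (frag_of (f, 1))"
| "pabs (CPoint A h) f = cmod (h f)"

definition berkovich_points ::
  "('k::field_char_0 \<Rightarrow> 'f::field) \<Rightarrow> 'f set set \<Rightarrow> 'k set \<Rightarrow> ('k, 'f) point set" where
  "berkovich_points \<iota> Xs p = {NPoint A N | A N. A \<in> Xs \<and>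
     (let Z = {z. Poly_Mapping.keys z \<subseteq> A \<times> cauchy_seqs p} in
       (\<forall>z. z \<notin> Z \<longrightarrow> N z = 0) \<and>
       (\<forall>z\<in>Z. N z \<ge> 0) \<and>
       (\<forall>z\<in>Z. \<forall>w\<in>Z. N (z + w) \<le> N z + N w) \<and>
       (\<forall>z\<in>Z. \<forall>w\<in>Z. N (pair_prod z w) = N z * N w) \<and>
       (\<forall>z\<in>tensor_relations \<iota> (\<lambda>k n. k) A (cauchy_seqs p). N z = 0) \<and>
       (\<forall>c\<in>cauchy_seqs p. N (frag_of (1, c)) = completion_abs p c) \<and>
       (\<forall>f\<in>A. N (frag_of (f, 1)) = 0 \<longleftrightarrow> f \<notin> runits A))}"

definition complex_points ::
  "('k::field_char_0 \<Rightarrow> 'f::field) \<Rightarrow> 'f set set \<Rightarrow> ('k \<Rightarrow> complex) \<Rightarrow> ('k, 'f) point set" where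
  "complex_points \<iota> Xs \<sigma> = {CPoint A h | A h. A \<in> Xs \<and>
     (\<forall>f. f \<notin> A \<longrightarrow> h f = 0) \<and>
     h \<in> ring_hom (ring_on A) field_ring \<and>
     (\<forall>k. h (\<iota> k) = \<sigma> k) \<and>
     (\<forall>f\<in>A. h f = 0 \<longleftrightarrow> f \<notin> runits A)}"

text \<open>In both cases the topology is the coarsest one for which the preimages of Zariski open
  sets are open and regular functions (over \<open>K\<^sub>v\<close>) on them have continuous absolute value,
  resp. are continuous.\<close>

fun an_top ::
  "('k::field_char_0 \<Rightarrow> 'f::field) \<Rightarrow> 'f set set \<Rightarrow> 'k place \<Rightarrow> ('k, 'f) point topology" where
  "an_top \<iota> Xs (Fin p) = topology_generated_by
     {{NPoint A N | A N. NPoint A N \<in> berkovich_points \<iota> Xs p \<and>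
         Poly_Mapping.keys z \<subseteq> A \<times> cauchy_seqs p \<and> N z \<in> W} | z W. open W}"
| "an_top \<iota> Xs (Emb \<sigma>) = topology_generated_by
     {{CPoint A h | A h. CPoint A h \<in> complex_points \<iota> Xs \<sigma> \<and> f \<in> A \<and> h f \<in> W} | f W. open W}"

abbreviation an ::
  "('k::field_char_0 \<Rightarrow> 'f::field) \<Rightarrow> 'f set set \<Rightarrow> 'k place \<Rightarrow> ('k, 'f) point set" where
  "an \<iota> Xs v \<equiv> topspace (an_top \<iota> Xs v)"

fun F_inf :: "('k, 'f) point \<Rightarrow> ('k, 'f) point" where
  "F_inf (NPoint A N) = NPoint A N"
| "F_inf (CPoint A h) = CPoint A (cnj \<circ> h)"

definition off_supp ::
  "('k::field_char_0 \<Rightarrow> 'f::field) \<Rightarrow> 'f set set \<Rightarrow> 'k place \<Rightarrow> 'f rdiv \<Rightarrow> ('k, 'f) point set" where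
  "off_supp \<iota> Xs v D = {x \<in> an \<iota> Xs v. local_ring x \<notin> Supp Xs D}"

text \<open>\<open>log |\<phi>|\<^sub>x\<close> for \<open>\<phi> = \<Prod> u\<^sub>i\<^bsup>a\<^sub>i\<^esup>\<close> with real exponents and units \<open>u\<^sub>i\<close> of the local ring at \<open>x\<close>,
  that is, for \<open>x\<close> outside the support of \<open>(\<phi>)\<close>.\<close>

definition log_abs :: "('k::field_char_0, 'f::field) point \<Rightarrow> 'f rrat \<Rightarrow> real" where
  "log_abs x \<phi> = (THE l. \<exists>z\<in>\<phi>. Poly_Mapping.keys z \<subseteq> runits (local_ring x) \<and>
     l = (\<Sum>a\<in>Poly_Mapping.keys z. Poly_Mapping.lookup z a * ln (pabs x a)))"


section \<open>Green functions and adelic divisors\<close>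

text \<open>Green functions of \<open>D\<close> are defined off the support of \<open>D\<close>; outside this domain their
  value is set to \<open>0\<close>.\<close>

definition green ::
  "('k::field_char_0 \<Rightarrow> 'f::field) \<Rightarrow> 'f set set \<Rightarrow> 'k place \<Rightarrow> 'f rdiv \<Rightarrow>
   (('k, 'f) point \<Rightarrow> real) \<Rightarrow> bool" where
  "green \<iota> Xs v D g \<longleftrightarrow>
     (\<forall>x. x \<notin> off_supp \<iota> Xs v D \<longrightarrow> g x = 0) \<and>
     (\<forall>U \<phi>. openin (zariski Xs) U \<and> local_equation D U \<phi> \<longrightarrow>
       (\<forall>x \<in> an \<iota> Xs v. local_ring x \<in> U \<longrightarrow>
         (\<exists>W u. openin (an_top \<iota> Xs v) W \<and> x \<in> W \<and> (\<forall>y\<in>W. local_ring y \<in> U) \<and>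
            continuous_map (subtopology (an_top \<iota> Xs v) W) euclideanreal u \<and>
            (\<forall>y\<in>W \<inter> off_supp \<iota> Xs v D. u y = g y + 2 * log_abs y \<phi>))))"

text \<open>Regular functions on the open subscheme of \<open>Spec O\<^sub>K\<close> with set of closed points \<open>U\<close>.\<close>

definition OK_open :: "'k::field_char_0 set set \<Rightarrow> 'k set" where
  "OK_open U = (\<Inter>p\<in>U. {b / c | b c. b \<in> OK \<and> c \<in> OK - p})"

definition is_model ::
  "('k::field_char_0 \<Rightarrow> 'f::field) \<Rightarrow> 'f set set \<Rightarrow> 'f rdiv \<Rightarrow> 'k set set \<Rightarrow>
   'f set set \<Rightarrow> 'f rdiv \<Rightarrow> bool" where
  "is_model \<iota> Xs D U Y E \<longleftrightarrow>
     U \<subseteq> MK \<and> finite (MK - U) \<and> projective_integral \<iota> (OK_open U) Y \<and>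
     {A \<in> Y. range \<iota> \<subseteq> A} = Xs \<and> E \<in> div_R Y \<and> restrict_rdiv Xs E = D"

text \<open>\<open>B\<close> is the image of the closed point of the valuation ring of the residue field at \<open>x\<close>.\<close>

definition reduction :: "'f::field set set \<Rightarrow> ('k::field_char_0, 'f) point \<Rightarrow> 'f set \<Rightarrow> bool" where
  "reduction Y x B \<longleftrightarrow> B \<in> Y \<and> B \<subseteq> local_ring x \<and>
     (\<forall>f\<in>B. pabs x f \<le> 1 \<and> (pabs x f < 1 \<longleftrightarrow> f \<notin> runits B))"

definition model_green ::
  "('k::field_char_0 \<Rightarrow> 'f::field) \<Rightarrow> 'f set set \<Rightarrow> 'f rdiv \<Rightarrow> 'f set set \<Rightarrow> 'f rdiv \<Rightarrow>
   'k set \<Rightarrow> (('k, 'f) point \<Rightarrow> real) \<Rightarrow> bool" where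
  "model_green \<iota> Xs D Y E p g \<longleftrightarrow>
     (\<forall>x\<in>off_supp \<iota> Xs (Fin p) D. \<forall>B V \<phi>.
        reduction Y x B \<and> openin (zariski Y) V \<and> B \<in> V \<and> local_equation E V \<phi> \<longrightarrow>
        g x = - 2 * log_abs x \<phi>)"

type_synonym ('k, 'f) adiv = "'f rdiv \<times> ('k place \<Rightarrow> ('k, 'f) point \<Rightarrow> real)"

definition adelic_div ::
  "('k::field_char_0 \<Rightarrow> 'f::field) \<Rightarrow> 'f set set \<Rightarrow> ('k, 'f) adiv set" where
  "adelic_div \<iota> Xs = {(D, g). D \<in> div_R Xs \<and>
     (\<forall>v\<in>places. green \<iota> Xs v D (g v)) \<and> (\<forall>v. v \<notin> places \<longrightarrow> g v = (\<lambda>x. 0)) \<and>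
     (\<exists>U Y E. is_model \<iota> Xs D U Y E \<and>
        finite {p\<in>MK. \<not> (p \<in> U \<and> model_green \<iota> Xs D Y E p (g (Fin p)))}) \<and>
     (\<forall>\<sigma>\<in>embeddings. \<forall>x\<in>an \<iota> Xs (Emb \<sigma>). g (Emb (cnj \<circ> \<sigma>)) (F_inf x) = g (Emb \<sigma>) x)}"

text \<open>Continuous extension of \<open>f\<close> from the dense subset \<open>S\<close>: the value at a point outside \<open>S\<close>
  is the limit of \<open>f\<close> along \<open>S\<close>, written as a lower limit in order to have a total function.\<close>

definition cont_ext :: "'a topology \<Rightarrow> 'a set \<Rightarrow> ('a \<Rightarrow> real) \<Rightarrow> 'a \<Rightarrow> ereal" where
  "cont_ext T S f x =
     (if x \<in> S then ereal (f x) else Liminf (atin_within T x S) (\<lambda>y. ereal (f y)))"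

text \<open>The sum of two Green functions is defined off both supports; since the support of the
  sum of the divisors may be smaller, it has to be extended by continuity.\<close>

definition ad_add ::
  "('k::field_char_0 \<Rightarrow> 'f::field) \<Rightarrow> 'f set set \<Rightarrow>
   ('k, 'f) adiv \<Rightarrow> ('k, 'f) adiv \<Rightarrow> ('k, 'f) adiv" where
  "ad_add \<iota> Xs P Q =
     (let D = rt_add (cartier Xs) (fst P) (fst Q) in
      (D, \<lambda>v x. if v \<in> places \<and> x \<in> off_supp \<iota> Xs v D
         then real_of_ereal (cont_ext (an_top \<iota> Xs v)
                (off_supp \<iota> Xs v (fst P) \<inter> off_supp \<iota> Xs v (fst Q))
                (\<lambda>y. snd P v y + snd Q v y) x)
         else 0))"

definition ad_scale :: "'f::field set set \<Rightarrow> real \<Rightarrow> ('k, 'f) adiv \<Rightarrow> ('k, 'f) adiv" where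
  "ad_scale Xs r P = (rt_scale (cartier Xs) r (fst P), \<lambda>v x. r * snd P v x)"

definition ad_zero :: "'f::field set set \<Rightarrow> ('k, 'f) adiv" where
  "ad_zero Xs = (rclass (cartier Xs) 0, \<lambda>v x. 0)"

definition ad_principal ::
  "('k::field_char_0 \<Rightarrow> 'f::field) \<Rightarrow> 'f set set \<Rightarrow> 'f rrat \<Rightarrow> ('k, 'f) adiv" where
  "ad_principal \<iota> Xs \<phi> = (principal_rdiv Xs \<phi>,
     \<lambda>v x. if v \<in> places \<and> x \<in> off_supp \<iota> Xs v (principal_rdiv Xs \<phi>)
       then - 2 * log_abs x \<phi> else 0)"

definition ad_effective ::
  "('k::field_char_0 \<Rightarrow> 'f::field) \<Rightarrow> 'f set set \<Rightarrow> ('k, 'f) adiv \<Rightarrow> bool" where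
  "ad_effective \<iota> Xs P \<longleftrightarrow> effective_rdiv Xs (fst P) \<and>
     (\<forall>v\<in>places. \<forall>x\<in>off_supp \<iota> Xs v (fst P). snd P v x \<ge> 0)"

definition ad_le ::
  "('k::field_char_0 \<Rightarrow> 'f::field) \<Rightarrow> 'f set set \<Rightarrow> ('k, 'f) adiv \<Rightarrow> ('k, 'f) adiv \<Rightarrow> bool" where
  "ad_le \<iota> Xs P Q \<longleftrightarrow> ad_effective \<iota> Xs (ad_add \<iota> Xs Q (ad_scale Xs (-1) P))"

definition ad_subspace ::
  "('k::field_char_0 \<Rightarrow> 'f::field) \<Rightarrow> 'f set set \<Rightarrow> ('k, 'f) adiv set \<Rightarrow> bool" where
  "ad_subspace \<iota> Xs V \<longleftrightarrow> V \<subseteq> adelic_div \<iota> Xs \<and> ad_zero Xs \<in> V \<and>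
     (\<forall>P\<in>V. \<forall>Q\<in>V. ad_add \<iota> Xs P Q \<in> V) \<and> (\<forall>P\<in>V. \<forall>r. ad_scale Xs r P \<in> V)"

text \<open>\<open>|s|\<^bsub>g\<^sub>v\<^esub> = |s|\<^sub>v exp (- g\<^sub>v / 2)\<close>, extended by continuity across the supports of \<open>D\<close> and \<open>(s)\<close>.\<close>

definition section_norm ::
  "('k::field_char_0 \<Rightarrow> 'f::field) \<Rightarrow> 'f set set \<Rightarrow> ('k, 'f) adiv \<Rightarrow> 'f rrat \<Rightarrow> 'k place \<Rightarrow>
   ('k, 'f) point \<Rightarrow> ereal" where
  "section_norm \<iota> Xs P s v = cont_ext (an_top \<iota> Xs v)
     (off_supp \<iota> Xs v (fst P) \<inter> off_supp \<iota> Xs v (principal_rdiv Xs s))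
     (\<lambda>y. exp (log_abs y s) * exp (- snd P v y / 2))"

definition nonneg_cont ::
  "('k::field_char_0 \<Rightarrow> 'f::field) \<Rightarrow> 'f set set \<Rightarrow> 'k place \<Rightarrow> (('k, 'f) point \<Rightarrow> real) set" where
  "nonneg_cont \<iota> Xs v = {f. continuous_map (an_top \<iota> Xs v) euclideanreal f \<and>
     (\<forall>x\<in>an \<iota> Xs v. f x \<ge> 0)}"

definition O_bar ::
  "('k::field_char_0 \<Rightarrow> 'f::field) \<Rightarrow> 'f set set \<Rightarrow> 'k place \<Rightarrow>
   (('k, 'f) point \<Rightarrow> real) \<Rightarrow> ('k, 'f) adiv" where
  "O_bar \<iota> Xs v f = (rclass (cartier Xs) 0,
     \<lambda>w x. if x \<in> an \<iota> Xs w then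
         (case v of
            Fin p \<Rightarrow> (if w = v then f x else 0)
          | Emb \<sigma> \<Rightarrow> (if w = v then f x / 2 else 0) +
                    (if w = conj_place v then f (F_inf x) / 2 else 0))
       else 0)"


section \<open>Directional derivatives\<close>

definition upper_deriv ::
  "('k::field_char_0 \<Rightarrow> 'f::field) \<Rightarrow> 'f set set \<Rightarrow> (('k, 'f) adiv \<Rightarrow> real) \<Rightarrow>
   ('k, 'f) adiv \<Rightarrow> ('k, 'f) adiv \<Rightarrow> ereal" where
  "upper_deriv \<iota> Xs \<mu> E D = Limsup (at_right 0)
     (\<lambda>\<epsilon>. ereal ((\<mu> (ad_add \<iota> Xs D (ad_scale Xs \<epsilon> E)) - \<mu> D) / \<epsilon>))"

definition monotone_part ::
  "('k::field_char_0 \<Rightarrow> 'f::field) \<Rightarrow> 'f set set \<Rightarrow>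
   (('k, 'f) adiv \<Rightarrow> ('k, 'f) adiv \<Rightarrow> ereal) \<Rightarrow> ('k, 'f) adiv set \<Rightarrow> ('k, 'f) adiv set" where
  "monotone_part \<iota> Xs nabla C = {D \<in> C. \<forall>E1\<in>adelic_div \<iota> Xs. \<forall>E2\<in>adelic_div \<iota> Xs.
     ad_effective \<iota> Xs E1 \<and> ad_effective \<iota> Xs E2 \<and> ad_le \<iota> Xs E1 E2 \<longrightarrow> nabla E1 D \<le> nabla E2 D}"

definition Psi ::
  "('k::field_char_0 \<Rightarrow> 'f::field) \<Rightarrow> 'f set set \<Rightarrow>
   (('k, 'f) adiv \<Rightarrow> ('k, 'f) adiv \<Rightarrow> ereal) \<Rightarrow> ('k, 'f) adiv \<Rightarrow> 'k place \<Rightarrow>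
   (('k, 'f) point \<Rightarrow> real) \<Rightarrow> ereal" where
  "Psi \<iota> Xs nabla D v f = nabla (O_bar \<iota> Xs v f) D"

definition Supp_Psi ::
  "('k::field_char_0 \<Rightarrow> 'f::field) \<Rightarrow> 'f set set \<Rightarrow>
   (('k, 'f) adiv \<Rightarrow> ('k, 'f) adiv \<Rightarrow> ereal) \<Rightarrow> ('k, 'f) adiv \<Rightarrow> 'k place \<Rightarrow> ('k, 'f) point set" where
  "Supp_Psi \<iota> Xs nabla D v = {x \<in> an \<iota> Xs v. \<forall>f\<in>nonneg_cont \<iota> Xs v. f x > 0 \<longrightarrow> Psi \<iota> Xs nabla D v f > 0}"

end

theory Submission
  imports Defs
begin

text \<open>Let \<open>E = D + (s)\<close>, an effective divisor. Since \<open>D + \<epsilon> E = (1 + \<epsilon>) D + (\<epsilon> s)\<close>, homogeneity and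
  invariance of \<open>\<mu>\<close> together with \<open>\<mu> D = 0\<close> give \<open>\<nabla>(E, D) = 0\<close>. The function \<open>exp (- g\<^sub>E)\<close>,
  which is \<open>|s|\<^sup>2\<close> for the metric of \<open>D\<close>, extends by zero across the support of \<open>E\<close> to a continuous
  function, so that \<open>f = 1 - exp (- g\<^sub>E)\<close> is continuous, \<open>0 \<le> f \<le> g\<^sub>E\<close>, and \<open>f\<close> is positive where
  \<open>|s| < 1\<close>. Hence \<open>O(f) \<le> E\<close>, and monotonicity gives \<open>\<Psi>(f) \<le> \<nabla>(E, D) = 0\<close>.

  Divisors with real coefficients are reduced to integral ones by expanding the coefficients in a
  basis of \<open>\<real>\<close> over \<open>\<rat>\<close>: this makes \<open>log |\<phi>|\<close> well-defined, and shows that a positive real combination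
  of local equations is trivial only if all of them are units.\<close>

section \<open>Formal real sums\<close>

text \<open>The function 1 - exp (- t) is a bounded substitute: it is at most t, positive for t > 0,
  and has a limit at infinity. Its continuity rests on an algebraic fact. The support of a real
  divisor is defined by the vanishing of a class in a tensor product with \<real>, and for the zero
  extension of exp (- g_E) to be continuous this support has to be exactly the locus where some
  local equation with positive coefficient vanishes. A second obstacle is that O(f) need not lie in
  V, so \<open>nabla\<close> at O(f) is not known to be a derivative; monotonicity compares it with
  the value at E, which does lie in V. Finally, \<open>\<mu>\<close> is an arbitrary function of
  pairs (D, g). The identity between D + \<epsilon> E and (1 + \<epsilon>) D + (\<epsilon> s) must
  therefore be an equality of pairs, including the values of Green functions that arise by
  extension.\<close>

abbreviation "single \<equiv> Poly_Mapping.single"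
abbreviation "lookup \<equiv> Poly_Mapping.lookup"
abbreviation "keys \<equiv> Poly_Mapping.keys"

lemma lookup_pscale [simp]: "lookup (pscale r z) a = r * lookup z a"
  by (simp add: pscale_def map.rep_eq when_def)

interpretation fs: vector_space "pscale :: real \<Rightarrow> ('g \<Rightarrow>\<^sub>0 real) \<Rightarrow> _"
  by unfold_locales (auto intro!: poly_mapping_eqI simp: lookup_add algebra_simps)

lemma keys_pscale_subset: "keys (pscale r z) \<subseteq> keys z"
  by (auto simp: Poly_Mapping.in_keys_iff)

lemma pscale_single: "pscale r (single a x) = single a (r * x)"
  by (rule poly_mapping_eqI) (simp add: lookup_single when_def)

lemma poly_mapping_sum_single:
  fixes z :: "'g \<Rightarrow>\<^sub>0 real"
  shows "z = (\<Sum>a\<in>keys z. pscale (lookup z a) (single a 1))"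
  by (rule poly_mapping_eqI)
    (auto simp: lookup_sum lookup_single when_def Poly_Mapping.in_keys_iff if_distrib sum.delta cong: if_cong)

lemma push_superset:
  assumes "finite T" "keys z \<subseteq> T"
  shows "push f z = (\<Sum>a\<in>T. single (f a) (lookup z a))"
  unfolding push_def by (rule sum.mono_neutral_left) (use assms in \<open>auto simp: Poly_Mapping.in_keys_iff\<close>)

lemma push_add: "push f (z + w) = push f z + push f w"
proof -
  let ?T = "keys z \<union> keys w"
  have "push f (z + w) = (\<Sum>a\<in>?T. single (f a) (lookup (z + w) a))"
    by (rule push_superset) (use Poly_Mapping.keys_add[of z w] in auto)
  also have "\<dots> = push f z + push f w"
    by (simp add: push_superset[of ?T z] push_superset[of ?T w] lookup_add single_add sum.distrib)
  finally show ?thesis .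
qed

lemma push_pscale: "push f (pscale r z) = pscale r (push f z)"
  by (simp add: push_superset[OF finite_keys keys_pscale_subset, of f r z] push_def[of f z]
      fs.scale_sum_right pscale_single)

lemma push_single [simp]: "push f (single a r) = single (f a) r"
  by (cases "r = 0") (simp_all add: push_def)

lemma push_zero [simp]: "push f 0 = 0"
  by (simp add: push_def)

lemma push_diff: "push f (z - w) = push f z - push f w"
  using push_add[of f "z - w" w] by simp

lemma push_sum: "push f (\<Sum>i\<in>I. z i) = (\<Sum>i\<in>I. push f (z i))"
  by (induction I rule: infinite_finite_induct) (simp_all add: push_add)

lemma push_push: "push g (push f z) = push (g \<circ> f) z"
  by (simp add: push_def[of f] push_def[of "g \<circ> f"] push_sum)

lemma push_cong: "(\<And>a. a \<in> keys z \<Longrightarrow> f a = g a) \<Longrightarrow> push f z = push g z"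
  by (simp add: push_def)

lemma keys_sum_subset: "keys (\<Sum>i\<in>I. z i) \<subseteq> (\<Union>i\<in>I. keys (z i))"
  by (induction I rule: infinite_finite_induct) (auto dest!: subsetD[OF Poly_Mapping.keys_add])

lemma keys_push: "keys (push f z) \<subseteq> f ` keys z"
  unfolding push_def using keys_sum_subset[of "\<lambda>a. single (f a) (lookup z a)" "keys z"]
  by (fastforce split: if_splits)

lemma lookup_push_pos:
  assumes pos: "\<And>a. a \<in> keys z \<Longrightarrow> lookup z a > 0" and "b \<in> keys (push f z)"
  shows "lookup (push f z) b > 0"
proof -
  have "lookup (push f z) b = (\<Sum>a\<in>keys z. lookup z a when f a = b)"
    by (simp add: push_def lookup_sum lookup_single)
  also have "\<dots> \<ge> 0"
    by (rule sum_nonneg) (auto simp: when_def intro: less_imp_le[OF pos])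
  finally show ?thesis using assms(2) by (simp add: Poly_Mapping.in_keys_iff)
qed

text \<open>Positive coefficients cannot cancel when \<open>f\<close> merges several indices, so no
  key of the image is lost.\<close>

lemma keys_push_pos:
  assumes pos: "\<And>a. a \<in> keys z \<Longrightarrow> lookup z a > 0"
  shows "keys (push f z) = f ` keys z"
proof (rule antisym[OF keys_push], clarify)
  fix a assume a: "a \<in> keys z"
  have "0 < lookup z a" using pos a .
  also have "\<dots> \<le> (\<Sum>b\<in>keys z. lookup z b when f b = f a)"
    using member_le_sum[OF a, of "\<lambda>b. lookup z b when f b = f a"] pos
    by (force simp: when_def intro: less_imp_le)
  also have "\<dots> = lookup (push f z) (f a)"
    by (simp add: push_def lookup_sum lookup_single)
  finally show "f a \<in> keys (push f z)" by (simp add: Poly_Mapping.in_keys_iff)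
qed


section \<open>Real tensor products\<close>

lemma sum_relations_subspace: "fs.subspace (sum_relations G)"
  by (simp add: sum_relations_def)

lemmas sum_relations_zero [simp] = fs.subspace_0[OF sum_relations_subspace]
  and sum_relations_add = fs.subspace_add[OF sum_relations_subspace]
  and sum_relations_scale = fs.subspace_scale[OF sum_relations_subspace]

lemma sum_relations_minus_commute: "(z :: 'g \<Rightarrow>\<^sub>0 real) - w \<in> sum_relations G \<longleftrightarrow> w - z \<in> sum_relations G"
  using sum_relations_scale[of "z - w" G "-1"] sum_relations_scale[of "w - z" G "-1"]
  by (auto simp: fs.scale_minus_left)

lemma sum_relations_diff_trans:
  "z - w \<in> sum_relations G \<Longrightarrow> w - y \<in> sum_relations G \<Longrightarrow> z - y \<in> sum_relations G"
  using sum_relations_add[of "z - w" G "w - y"] by simp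

lemma sum_relations_base:
  "a \<in> carrier G \<Longrightarrow> b \<in> carrier G \<Longrightarrow>
   single (a \<otimes>\<^bsub>G\<^esub> b) 1 - single a 1 - single b 1 \<in> sum_relations G"
  unfolding sum_relations_def by (rule fs.span_base) blast

lemma formal_sums_add: "z \<in> formal_sums G \<Longrightarrow> w \<in> formal_sums G \<Longrightarrow> z + w \<in> formal_sums G"
  using Poly_Mapping.keys_add[of z w] by (auto simp: formal_sums_def)

lemma formal_sums_scale: "z \<in> formal_sums G \<Longrightarrow> pscale r z \<in> formal_sums G"
  using keys_pscale_subset[of r z] by (auto simp: formal_sums_def)

lemma formal_sums_zero [simp]: "0 \<in> formal_sums G"
  by (simp add: formal_sums_def)

lemma rclass_eq_iff:
  assumes "z \<in> formal_sums G"
  shows "rclass G z = rclass G w \<longleftrightarrow> z - w \<in> sum_relations G"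
proof
  have "z \<in> rclass G z" using assms by (simp add: rclass_def)
  moreover assume "rclass G z = rclass G w"
  ultimately have "z \<in> rclass G w" by simp
  then show "z - w \<in> sum_relations G" by (simp add: rclass_def)
next
  assume "z - w \<in> sum_relations G"
  then show "rclass G z = rclass G w"
    using sum_relations_diff_trans sum_relations_minus_commute unfolding rclass_def by blast
qed

lemma rclass_eqI: "z - w \<in> sum_relations G \<Longrightarrow> rclass G z = rclass G w"
  using sum_relations_diff_trans sum_relations_minus_commute unfolding rclass_def by blast

lemma rclass_self: "z \<in> formal_sums G \<Longrightarrow> z \<in> rclass G z"
  by (simp add: rclass_def)

lemma real_tensor_cases:
  assumes "c \<in> real_tensor G"
  obtains z where "z \<in> formal_sums G" "c = rclass G z"
  using assms by (auto simp: real_tensor_def)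

lemma rclass_in: "z \<in> formal_sums G \<Longrightarrow> rclass G z \<in> real_tensor G"
  by (simp add: real_tensor_def)

text \<open>The union in \<open>rt_add\<close> runs over all pairs of representatives. All pairs
  yield the same class and at least one pair exists, so the union collapses to that class.\<close>

lemma rt_add_rclass:
  assumes "z \<in> formal_sums G" "w \<in> formal_sums G"
  shows "rt_add G (rclass G z) (rclass G w) = rclass G (z + w)"
proof -
  have "rclass G (z' + w') = rclass G (z + w)" if "z' \<in> rclass G z" "w' \<in> rclass G w" for z' w'
  proof (rule rclass_eqI)
    have "(z' - z) + (w' - w) \<in> sum_relations G"
      using that by (intro sum_relations_add) (auto simp: rclass_def)
    then show "z' + w' - (z + w) \<in> sum_relations G" by (simp add: algebra_simps)
  qed
  then show ?thesis
    using rclass_self[OF assms(1)] rclass_self[OF assms(2)] unfolding rt_add_def by blast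
qed

lemma rt_scale_rclass:
  assumes "z \<in> formal_sums G"
  shows "rt_scale G r (rclass G z) = rclass G (pscale r z)"
proof -
  have "rclass G (pscale r z') = rclass G (pscale r z)" if "z' \<in> rclass G z" for z'
    using that sum_relations_scale[of "z' - z" G r]
    by (intro rclass_eqI) (auto simp: rclass_def fs.scale_right_diff_distrib)
  then show ?thesis
    using rclass_self[OF assms(1)] unfolding rt_scale_def by blast
qed

lemma push_formal_sums: "f \<in> hom G H \<Longrightarrow> z \<in> formal_sums G \<Longrightarrow> push f z \<in> formal_sums H"
  using keys_push[of f z] by (fastforce simp: formal_sums_def hom_def)

lemma push_sum_relations:
  assumes f: "f \<in> hom G H" and "z \<in> sum_relations G"
  shows "push f z \<in> sum_relations H"
  using assms(2) unfolding sum_relations_def[of G]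
proof (induction rule: fs.span_induct_alt)
  case base
  then show ?case by simp
next
  case (step c x y)
  then obtain a b where "a \<in> carrier G" "b \<in> carrier G"
    "x = single (a \<otimes>\<^bsub>G\<^esub> b) 1 - single a 1 - single b 1" by blast
  with f have "push f x \<in> sum_relations H"
    by (simp add: push_diff hom_mult sum_relations_base hom_in_carrier)
  then show ?case
    using step by (simp add: push_add push_pscale sum_relations_add sum_relations_scale)
qed

lemma rt_map_rclass:
  assumes f: "f \<in> hom G H" and z: "z \<in> formal_sums G"
  shows "rt_map H f (rclass G z) = rclass H (push f z)"
proof -
  have "rclass H (push f z') = rclass H (push f z)" if "z' \<in> rclass G z" for z'
    using that push_sum_relations[OF f, of "z' - z"]
    by (intro rclass_eqI) (auto simp: rclass_def push_diff)
  then show ?thesis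
    using rclass_self[OF z] unfolding rt_map_def by blast
qed

lemma rt_add_in: "c \<in> real_tensor G \<Longrightarrow> d \<in> real_tensor G \<Longrightarrow> rt_add G c d \<in> real_tensor G"
  by (elim real_tensor_cases) (simp add: rt_add_rclass rclass_in formal_sums_add)

lemma rt_scale_in: "c \<in> real_tensor G \<Longrightarrow> rt_scale G r c \<in> real_tensor G"
  by (elim real_tensor_cases) (simp add: rt_scale_rclass rclass_in formal_sums_scale)

lemma rt_map_in: "f \<in> hom G H \<Longrightarrow> c \<in> real_tensor G \<Longrightarrow> rt_map H f c \<in> real_tensor H"
  by (elim real_tensor_cases) (simp add: rt_map_rclass rclass_in push_formal_sums)

lemma rt_map_add:
  "f \<in> hom G H \<Longrightarrow> c \<in> real_tensor G \<Longrightarrow> d \<in> real_tensor G \<Longrightarrow>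
   rt_map H f (rt_add G c d) = rt_add H (rt_map H f c) (rt_map H f d)"
  by (elim real_tensor_cases)
    (simp add: rt_add_rclass rt_map_rclass push_formal_sums formal_sums_add push_add)

lemma rt_map_scale:
  "f \<in> hom G H \<Longrightarrow> c \<in> real_tensor G \<Longrightarrow>
   rt_map H f (rt_scale G r c) = rt_scale H r (rt_map H f c)"
  by (elim real_tensor_cases)
    (simp add: rt_scale_rclass rt_map_rclass push_formal_sums formal_sums_scale push_pscale)

lemma rt_map_rt_map:
  "f \<in> hom G H \<Longrightarrow> g \<in> hom H K \<Longrightarrow> g \<circ> f \<in> hom G K \<Longrightarrow> c \<in> real_tensor G \<Longrightarrow>
   rt_map K g (rt_map H f c) = rt_map K (g \<circ> f) c"
  by (elim real_tensor_cases) (simp add: rt_map_rclass push_formal_sums push_push)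

lemma rt_map_zero: "f \<in> hom G H \<Longrightarrow> rt_map H f (rclass G 0) = rclass H 0"
  by (simp add: rt_map_rclass)

lemma rt_add_zero:
  "c \<in> real_tensor G \<Longrightarrow> rt_add G c (rclass G 0) = c"
  by (elim real_tensor_cases) (simp add: rt_add_rclass)

lemma rt_add_zero_left:
  "c \<in> real_tensor G \<Longrightarrow> rt_add G (rclass G 0) c = c"
  by (elim real_tensor_cases) (simp add: rt_add_rclass)

lemma rt_scale_zero_class: "rt_scale G r (rclass G 0) = rclass G 0"
  by (simp add: rt_scale_rclass)

lemma rt_scale_eq_zero_iff:
  assumes "c \<in> real_tensor G" "r \<noteq> 0"
  shows "rt_scale G r c = rclass G 0 \<longleftrightarrow> c = rclass G 0"
proof -
  obtain z where z: "z \<in> formal_sums G" "c = rclass G z"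
    using assms(1) by (rule real_tensor_cases)
  have "pscale r z \<in> sum_relations G \<longleftrightarrow> z \<in> sum_relations G"
    using sum_relations_scale[of z G r] sum_relations_scale[of "pscale r z" G "1 / r"] assms(2)
    by auto
  with z show ?thesis
    by (simp add: rt_scale_rclass rclass_eq_iff formal_sums_scale)
qed

text \<open>The divisor part of the identity that turns a perturbation in the direction D + (s) into
  a scaling of D followed by a principal translation.\<close>

lemma rt_combine:
  assumes "c \<in> real_tensor G" "d \<in> real_tensor G"
  shows "rt_add G c (rt_scale G e (rt_add G c d)) = rt_add G (rt_scale G (1 + e) c) (rt_scale G e d)"
  using assms
  by (elim real_tensor_cases)
    (simp add: rt_scale_rclass rt_add_rclass formal_sums_add formal_sums_scale
      fs.scale_right_distrib fs.scale_left_distrib add.assoc)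


section \<open>Relations modulo a subgroup of the multiplicative group\<close>

text \<open>Two subgroups occur: \<open>{1}\<close>, for relations that hold in the multiplicative
  group itself, and \<open>runits B\<close>, for relations between cosets modulo the units of a
  local ring.\<close>

definition mult_subgroup :: "'f::field set \<Rightarrow> bool" where
  "mult_subgroup H \<longleftrightarrow> 1 \<in> H \<and> 0 \<notin> H \<and> (\<forall>a\<in>H. \<forall>b\<in>H. a * b \<in> H) \<and> (\<forall>a\<in>H. inverse a \<in> H)"

lemma mult_subgroup_powi: "mult_subgroup H \<Longrightarrow> a \<in> H \<Longrightarrow> a powi k \<in> H"
proof -
  assume H: "mult_subgroup H" and a: "a \<in> H"
  have pow: "b ^ n \<in> H" if "b \<in> H" for b and n :: nat
    using that H by (induction n) (auto simp: mult_subgroup_def)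
  show ?thesis
    using pow a H by (simp add: power_int_def mult_subgroup_def)
qed

lemma mult_subgroup_prod: "mult_subgroup H \<Longrightarrow> (\<And>i. i \<in> I \<Longrightarrow> g i \<in> H) \<Longrightarrow> (\<Prod>i\<in>I. g i) \<in> H"
  by (induction I rule: infinite_finite_induct) (auto simp: mult_subgroup_def)

section \<open>Integral formal sums read as products\<close>

definition integral_sum :: "('f::field \<Rightarrow>\<^sub>0 real) \<Rightarrow> bool" where
  "integral_sum z \<longleftrightarrow> 0 \<notin> keys z \<and> (\<forall>a. lookup z a \<in> \<int>)"

text \<open>Evaluation of an integral formal sum in the multiplicative group. For such a sum the
  floor only changes the type of the coefficients, and keeping 0 out of the keys makes integer
  powers additive in the exponent.\<close>

definition fprod :: "('f::field \<Rightarrow>\<^sub>0 real) \<Rightarrow> 'f" where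
  "fprod z = (\<Prod>a\<in>keys z. a powi \<lfloor>lookup z a\<rfloor>)"

lemma fprod_superset: "finite T \<Longrightarrow> keys z \<subseteq> T \<Longrightarrow> fprod z = (\<Prod>a\<in>T. a powi \<lfloor>lookup z a\<rfloor>)"
  unfolding fprod_def by (rule prod.mono_neutral_left) (auto simp: Poly_Mapping.in_keys_iff)

lemma integral_sum_add: "integral_sum z \<Longrightarrow> integral_sum w \<Longrightarrow> integral_sum (z + w)"
  using Poly_Mapping.keys_add[of z w] by (auto simp: integral_sum_def lookup_add)

lemma integral_sum_scale: "integral_sum z \<Longrightarrow> integral_sum (pscale (of_int k) z)"
  using keys_pscale_subset[of "of_int k" z] by (auto simp: integral_sum_def)

lemma fprod_add:
  assumes "integral_sum z" "integral_sum w"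
  shows "fprod (z + w) = fprod z * fprod w"
proof -
  let ?T = "keys z \<union> keys w"
  have *: "a powi \<lfloor>lookup z a + lookup w a\<rfloor> = a powi \<lfloor>lookup z a\<rfloor> * a powi \<lfloor>lookup w a\<rfloor>"
    if "a \<in> ?T" for a
  proof -
    obtain i j :: int where "lookup z a = of_int i" "lookup w a = of_int j"
      using assms by (meson Ints_cases integral_sum_def)
    moreover have "a \<noteq> 0" using that assms by (auto simp: integral_sum_def)
    ultimately show ?thesis
      by (simp add: power_int_add flip: of_int_add)
  qed
  have "fprod (z + w) = (\<Prod>a\<in>?T. a powi \<lfloor>lookup (z + w) a\<rfloor>)"
    by (rule fprod_superset) (use Poly_Mapping.keys_add[of z w] in auto)
  also have "\<dots> = fprod z * fprod w"
    by (simp add: fprod_superset[of ?T z] fprod_superset[of ?T w] lookup_add * prod.distrib)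
  finally show ?thesis .
qed

lemma prod_powi: "(\<Prod>i\<in>I. g i :: 'f::field) powi k = (\<Prod>i\<in>I. g i powi k)"
  by (induction I rule: infinite_finite_induct) (simp_all add: power_int_mult_distrib)

lemma fprod_scale:
  assumes "integral_sum z"
  shows "fprod (pscale (of_int k) z) = fprod z powi k"
proof -
  have "a powi \<lfloor>of_int k * lookup z a\<rfloor> = (a powi \<lfloor>lookup z a\<rfloor>) powi k" for a
  proof -
    obtain i :: int where "lookup z a = of_int i"
      using assms by (meson Ints_cases integral_sum_def)
    then show ?thesis
      by (simp add: mult.commute power_int_mult flip: of_int_mult)
  qed
  then show ?thesis
    by (simp add: fprod_superset[OF finite_keys keys_pscale_subset, of "of_int k" z]
        fprod_def[of z] prod_powi)
qed

definition int_sums :: "'f::field set \<Rightarrow> ('f \<Rightarrow>\<^sub>0 real) set" where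
  "int_sums H = {z. integral_sum z \<and> fprod z \<in> H}"

lemma int_sums_add:
  "mult_subgroup H \<Longrightarrow> z \<in> int_sums H \<Longrightarrow> w \<in> int_sums H \<Longrightarrow> z + w \<in> int_sums H"
  by (auto simp: int_sums_def integral_sum_add fprod_add mult_subgroup_def)

lemma int_sums_scale:
  "mult_subgroup H \<Longrightarrow> z \<in> int_sums H \<Longrightarrow> pscale (of_int k) z \<in> int_sums H"
  by (auto simp: int_sums_def integral_sum_scale fprod_scale mult_subgroup_powi)

lemma int_sums_zero: "mult_subgroup H \<Longrightarrow> 0 \<in> int_sums H"
  by (simp add: int_sums_def integral_sum_def fprod_def mult_subgroup_def)

lemma integral_sum_single: "a \<noteq> 0 \<Longrightarrow> integral_sum (single a 1)"
  by (auto simp: integral_sum_def lookup_single when_def)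

lemma fprod_single: "fprod (single a 1) = a"
  by (simp add: fprod_def)

text \<open>Rational relations modulo \<open>H\<close>: clearing a denominator gives an integral sum
  whose product lies in \<open>H\<close>. They are closed under rational scalars only, which is why
  real coefficients are taken apart into rational coordinates.\<close>

definition rat_sums :: "'f::field set \<Rightarrow> ('f \<Rightarrow>\<^sub>0 real) set" where
  "rat_sums H = {z. \<exists>n>0::nat. pscale (of_nat n) z \<in> int_sums H}"

lemma rat_sums_add:
  assumes "mult_subgroup H" "z \<in> rat_sums H" "w \<in> rat_sums H"
  shows "z + w \<in> rat_sums H"
proof -
  obtain m n :: nat where mn: "m > 0" "n > 0" "pscale (of_nat m) z \<in> int_sums H"
    "pscale (of_nat n) w \<in> int_sums H"
    using assms by (auto simp: rat_sums_def)
  have "pscale (of_nat (m * n)) (z + w) =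
    pscale (of_int (int n)) (pscale (of_nat m) z) + pscale (of_int (int m)) (pscale (of_nat n) w)"
    by (simp add: fs.scale_right_distrib mult.commute)
  also have "\<dots> \<in> int_sums H"
    using assms(1) mn by (intro int_sums_add int_sums_scale)
  finally show ?thesis
    using mn unfolding rat_sums_def by (metis (mono_tags, lifting) mem_Collect_eq nat_0_less_mult_iff)
qed

lemma rat_sums_scale:
  assumes "mult_subgroup H" "z \<in> rat_sums H" "q \<in> \<rat>"
  shows "pscale q z \<in> rat_sums H"
proof -
  obtain n :: nat where n: "n > 0" "pscale (of_nat n) z \<in> int_sums H"
    using assms by (auto simp: rat_sums_def)
  obtain i k :: int where q: "k > 0" "q = of_int i / of_int k"
    using assms(3) by (rule Rats_cases')
  have "pscale (of_nat (n * nat k)) (pscale q z) = pscale (of_int i) (pscale (of_nat n) z)"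
    using q by (simp add: mult.commute)
  also have "\<dots> \<in> int_sums H"
    using assms(1) n by (intro int_sums_scale)
  finally show ?thesis
    using n q unfolding rat_sums_def by (intro CollectI exI[of _ "n * nat k"]) simp
qed

lemma rat_sums_zero: "mult_subgroup H \<Longrightarrow> 0 \<in> rat_sums H"
  unfolding rat_sums_def by (intro CollectI exI[of _ 1]) (simp add: int_sums_zero)

lemma int_sums_imp_rat_sums: "z \<in> int_sums H \<Longrightarrow> z \<in> rat_sums H"
  unfolding rat_sums_def by (intro CollectI exI[of _ 1]) simp

lemma rat_sums_sum:
  "mult_subgroup H \<Longrightarrow> (\<And>i. i \<in> I \<Longrightarrow> z i \<in> rat_sums H) \<Longrightarrow> (\<Sum>i\<in>I. z i) \<in> rat_sums H"
  by (induction I rule: infinite_finite_induct) (auto simp: rat_sums_zero rat_sums_add)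

text \<open>For a multiplicative subgroup \<open>H\<close> this is the kernel, given by generators,
  of the map from formal real sums of nonzero elements to the quotient group modulo \<open>H\<close>
  tensored with \<real>.\<close>

definition unit_relations :: "'f::field set \<Rightarrow> ('f \<Rightarrow>\<^sub>0 real) set" where
  "unit_relations H = fs.span
     ({single (a * b) 1 - single a 1 - single b 1 | a b. a \<noteq> 0 \<and> b \<noteq> 0} \<union> (\<lambda>h. single h 1) ` H)"

lemma sum_relations_rat_group:
  "sum_relations rat_group =
     fs.span {single (a * b) 1 - single a 1 - single b 1 | a b. (a::'f::field) \<noteq> 0 \<and> b \<noteq> 0}"
  by (simp add: sum_relations_def rat_group_def)

lemma sum_relations_subset_unit_relations: "sum_relations rat_group \<subseteq> unit_relations H"
  unfolding sum_relations_rat_group unit_relations_def by (rule fs.span_mono) blast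

lemma unit_relations_subspace: "fs.subspace (unit_relations H)"
  by (simp add: unit_relations_def)

lemmas unit_relations_zero = fs.subspace_0[OF unit_relations_subspace]
  and unit_relations_add = fs.subspace_add[OF unit_relations_subspace]
  and unit_relations_diff = fs.subspace_diff[OF unit_relations_subspace]
  and unit_relations_scale = fs.subspace_scale[OF unit_relations_subspace]
  and unit_relations_sum = fs.subspace_sum[OF unit_relations_subspace]

lemma single_in_unit_relations: "h \<in> H \<Longrightarrow> single h 1 \<in> unit_relations H"
  unfolding unit_relations_def by (rule fs.span_base) blast

lemma mult_in_unit_relations:
  assumes "a \<noteq> 0" "b \<noteq> 0"
  shows "single (a * b) 1 - single a 1 - single b 1 \<in> unit_relations H"
  unfolding unit_relations_def by (rule fs.span_base) (use assms in blast)

text \<open>Along the span, terms coming from \<open>H\<close> are collected in \<open>z'\<close>,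
  while terms \<open>[ab] - [a] - [b]\<close> are dropped as genuine relations.\<close>

lemma unit_relations_representative:
  assumes "z \<in> unit_relations H"
  obtains z' where "keys z' \<subseteq> H" "z - z' \<in> sum_relations rat_group"
proof -
  have "\<exists>z'. keys z' \<subseteq> H \<and> z - z' \<in> sum_relations rat_group"
    using assms unfolding unit_relations_def
  proof (induction rule: fs.span_induct_alt)
    case base
    then show ?case by (intro exI[of _ 0]) simp
  next
    case (step c x y)
    from step(2) obtain y' where y': "keys y' \<subseteq> H" "y - y' \<in> sum_relations rat_group" by auto
    consider a b where "a \<noteq> 0" "b \<noteq> 0" "x = single (a * b) 1 - single a 1 - single b 1"
      | h where "h \<in> H" "x = single h 1" using step(1) by auto
    then show ?case
    proof cases
      case 1
      then have "x \<in> sum_relations rat_group"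
        unfolding sum_relations_rat_group by (intro fs.span_base) blast
      then have "pscale c x + (y - y') \<in> sum_relations rat_group"
        using y' by (intro sum_relations_add sum_relations_scale)
      with y' show ?thesis by (intro exI[of _ y']) (simp add: add_diff_eq)
    next
      case 2
      then have "keys (pscale c x + y') \<subseteq> H"
        using y' Poly_Mapping.keys_add[of "pscale c x" y'] keys_pscale_subset[of c x] by auto
      with y' show ?thesis by (intro exI[of _ "pscale c x + y'"]) simp
    qed
  qed
  then show ?thesis using that by blast
qed

lemma relation_in_int_sums:
  assumes "mult_subgroup H" "a \<noteq> 0" "b \<noteq> 0"
  shows "single (a * b) 1 - single a 1 - single b 1 \<in> int_sums H"
proof -
  \<comment> \<open>Subtraction is written as scaling by the integer -1, so that the product
    formulas for sums and for integral multiples apply.\<close>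
  let ?n = "\<lambda>c::'a. pscale (of_int (-1)) (single c (1::real))"
  have eq: "single (a * b) 1 - single a 1 - single b (1::real) = single (a * b) 1 + ?n a + ?n b"
    by simp
  have 1: "integral_sum (single (a * b) (1::real))" "integral_sum (?n a)" "integral_sum (?n b)"
    using assms by (intro integral_sum_single integral_sum_scale; simp)+
  have 2: "fprod (?n c) = inverse c" if "c \<noteq> 0" for c
    using that by (subst fprod_scale) (simp_all add: integral_sum_single fprod_single power_int_minus)
  have "fprod (single (a * b) (1::real) + ?n a + ?n b) = (a * b) * inverse a * inverse b"
    using assms(2,3) unfolding fprod_add[OF integral_sum_add[OF 1(1,2)] 1(3)] fprod_add[OF 1(1,2)]
    by (simp only: 2[OF assms(2)] 2[OF assms(3)] fprod_single)
  also have "\<dots> = 1" using assms(2,3) by (simp add: field_simps)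
  finally show ?thesis
    using assms(1) integral_sum_add[OF integral_sum_add[OF 1(1,2)] 1(3)]
    unfolding eq by (simp only: int_sums_def mem_Collect_eq mult_subgroup_def)
qed


subsection \<open>Rational coordinates of the coefficients\<close>

interpretation qr: vector_space "\<lambda>(q::rat) (x::real). of_rat q * x"
  by unfold_locales (auto simp: algebra_simps of_rat_add of_rat_mult)

text \<open>The coordinate of \<open>x\<close> at \<open>b\<close> in a fixed basis of \<real> over
  the rationals, obtained by extending the empty set.\<close>

definition rat_coord :: "real \<Rightarrow> real \<Rightarrow> rat" where
  "rat_coord b x = qr.representation (qr.extend_basis {}) x b"

lemma rat_basis: "qr.independent (qr.extend_basis {})" "x \<in> qr.span (qr.extend_basis {})"
  using qr.independent_extend_basis[OF qr.independent_empty]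
    qr.span_extend_basis[OF qr.independent_empty] by auto

lemma rat_coord_add: "rat_coord b (x + y) = rat_coord b x + rat_coord b y"
  unfolding rat_coord_def by (simp add: qr.representation_add rat_basis)

lemma rat_coord_scale: "rat_coord b (of_rat q * x) = q * rat_coord b x"
  unfolding rat_coord_def by (simp add: qr.representation_scale rat_basis)

lemma rat_coord_zero [simp]: "rat_coord b 0 = 0"
  using rat_coord_scale[of b 0 0] by simp

lemma finite_rat_coord: "finite {b. rat_coord b x \<noteq> 0}"
  unfolding rat_coord_def by (rule qr.finite_representation)

lemma sum_rat_coord:
  assumes "finite B" "{b. rat_coord b x \<noteq> 0} \<subseteq> B"
  shows "(\<Sum>b\<in>B. b * of_rat (rat_coord b x)) = x"
proof -
  have "(\<Sum>b\<in>B. b * of_rat (rat_coord b x)) = (\<Sum>b | rat_coord b x \<noteq> 0. of_rat (rat_coord b x) * b)"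
    using assms by (intro sum.mono_neutral_cong_right) (auto simp: mult.commute)
  also have "\<dots> = x"
    unfolding rat_coord_def by (rule qr.sum_nonzero_representation_eq) (rule rat_basis)+
  finally show ?thesis .
qed

definition coord_sum :: "real \<Rightarrow> ('g \<Rightarrow>\<^sub>0 real) \<Rightarrow> ('g \<Rightarrow>\<^sub>0 real)" where
  "coord_sum b z = Poly_Mapping.map (\<lambda>x. of_rat (rat_coord b x)) z"

lemma lookup_coord_sum [simp]: "lookup (coord_sum b z) a = of_rat (rat_coord b (lookup z a))"
  by (simp add: coord_sum_def map.rep_eq when_def)

lemma keys_coord_sum: "keys (coord_sum b z) \<subseteq> keys z"
  by (auto simp: Poly_Mapping.in_keys_iff)

lemma coord_sum_add: "coord_sum b (z + w) = coord_sum b z + coord_sum b w"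
  by (rule poly_mapping_eqI) (simp add: lookup_add rat_coord_add of_rat_add)

text \<open>Rational linearity of the coordinates pulls out the integer coefficients of
  \<open>z\<close>, so that the real scalar \<open>c\<close> is replaced by its rational coordinate.
  This is the passage from real to rational spans.\<close>

lemma coord_sum_integral:
  assumes "integral_sum z"
  shows "coord_sum b (pscale c z) = pscale (of_rat (rat_coord b c)) z"
proof (rule poly_mapping_eqI)
  fix a
  obtain i :: int where i: "lookup z a = of_int i"
    using assms by (meson Ints_cases integral_sum_def)
  have "rat_coord b (c * of_int i) = of_int i * rat_coord b c"
    using rat_coord_scale[of b "of_int i" c] by (simp add: mult.commute)
  then show "lookup (coord_sum b (pscale c z)) a = lookup (pscale (of_rat (rat_coord b c)) z) a"
    by (simp add: i of_rat_mult mult.commute)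
qed

definition coord_support :: "('g \<Rightarrow>\<^sub>0 real) \<Rightarrow> real set" where
  "coord_support z = (\<Union>a\<in>keys z. {b. rat_coord b (lookup z a) \<noteq> 0})"

lemma finite_coord_support: "finite (coord_support z)"
  by (simp add: coord_support_def finite_rat_coord)

lemma lookup_coord_sum_eq:
  "lookup z a = (\<Sum>b\<in>coord_support z. b * lookup (coord_sum b z) a)"
proof (cases "a \<in> keys z")
  case True
  then have "{b. rat_coord b (lookup z a) \<noteq> 0} \<subseteq> coord_support z"
    by (auto simp: coord_support_def)
  then show ?thesis by (simp add: sum_rat_coord finite_coord_support)
qed (simp add: Poly_Mapping.in_keys_iff)

text \<open>The generators of \<open>unit_relations H\<close> are integral sums with product in
  \<open>H\<close>, and taking a coordinate turns their real scalars into rational ones.\<close>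

lemma coord_sum_in_rat_sums:
  assumes H: "mult_subgroup H" and z: "z \<in> unit_relations H"
  shows "coord_sum b z \<in> rat_sums H"
  using z unfolding unit_relations_def
proof (induction rule: fs.span_induct_alt)
  case base
  have "coord_sum b 0 = (0 :: 'a \<Rightarrow>\<^sub>0 real)" by (rule poly_mapping_eqI) simp
  then show ?case using H by (simp add: rat_sums_zero)
next
  case (step c x y)
  have x: "x \<in> int_sums H"
    using step(1) relation_in_int_sums[OF H] H
    by (auto simp: int_sums_def[of H] fprod_single mult_subgroup_def intro!: integral_sum_single
        dest: relation_in_int_sums[OF H])
  then have "integral_sum x" by (simp add: int_sums_def)
  then show ?case
    unfolding coord_sum_add coord_sum_integral[OF \<open>integral_sum x\<close>]
    using H int_sums_imp_rat_sums[OF x] step(2)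
    by (intro rat_sums_add rat_sums_scale) auto
qed

text \<open>A relation between elements of \<open>H\<close> may be derived by way of elements
  outside \<open>H\<close>, where \<open>L\<close> is not assumed additive, so an induction over the
  span does not go through. Each coordinate, cleared of denominators, is instead an honest identity
  between 1 and a product of powers of elements of \<open>H\<close>, to which \<open>L\<close>
  applies. It is used with \<open>L\<close> the logarithm of an absolute value and \<open>H\<close>
  the units of a local ring.\<close>

lemma sum_relations_additive:
  assumes z: "z \<in> sum_relations rat_group" "keys z \<subseteq> H" and H: "mult_subgroup H"
    and L: "\<And>a b. a \<in> H \<Longrightarrow> b \<in> H \<Longrightarrow> L (a * b) = L a + (L b :: real)"
  shows "(\<Sum>a\<in>keys z. lookup z a * L a) = 0"
proof -
  have L1: "L 1 = 0" using L[of 1 1] H by (simp add: mult_subgroup_def)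
  have pow: "a ^ n \<in> H" if "a \<in> H" for a and n :: nat
    using that H by (induction n) (auto simp: mult_subgroup_def)
  have Lpow: "L (a ^ n) = real n * L a" if "a \<in> H" for a n
    by (induction n) (simp_all add: L1 L[OF that pow[OF that]] algebra_simps)
  have Linv: "L (inverse a) = - L a" if "a \<in> H" for a
  proof -
    have "a \<noteq> 0" "inverse a \<in> H" using that H by (auto simp: mult_subgroup_def)
    with L[of a "inverse a"] that show ?thesis by (simp add: L1)
  qed
  have Lpowi: "L (a powi k) = of_int k * L a" if "a \<in> H" for a k
  proof -
    have "inverse a \<in> H" using that H by (simp add: mult_subgroup_def)
    then show ?thesis by (simp add: power_int_def Lpow[OF that] Lpow Linv[OF that])
  qed
  have Lprod: "L (\<Prod>a\<in>T. a powi k a) = (\<Sum>a\<in>T. of_int (k a) * L a)"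
    if "T \<subseteq> H" for T and k :: "'a \<Rightarrow> int"
    using that
  proof (induction T rule: infinite_finite_induct)
    case (insert x F)
    then have "x powi k x \<in> H" "(\<Prod>a\<in>F. a powi k a) \<in> H"
      by (auto intro!: mult_subgroup_prod mult_subgroup_powi H)
    with insert show ?case by (simp add: L Lpowi)
  qed (simp_all add: L1)
  have coord: "(\<Sum>a\<in>keys z. lookup (coord_sum b z) a * L a) = 0" for b
  proof -
    \<comment> \<open>The trivial subgroup is taken here and not \<open>H\<close>: the product has
      to be exactly 1 for \<open>L\<close> to vanish on it.\<close>
    have "mult_subgroup {1::'a}" by (simp add: mult_subgroup_def)
    then have "coord_sum b z \<in> rat_sums {1}"
      using sum_relations_subset_unit_relations z by (intro coord_sum_in_rat_sums) auto
    then obtain n :: nat where n: "n > 0" "pscale (of_nat n) (coord_sum b z) \<in> int_sums {1}"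
      by (auto simp: rat_sums_def)
    let ?w = "pscale (of_nat n) (coord_sum b z)"
    have int: "of_int \<lfloor>lookup ?w a\<rfloor> = lookup ?w a" for a
      using n unfolding int_sums_def integral_sum_def by (simp only: mem_Collect_eq of_int_floor)
    have "keys ?w \<subseteq> keys z" by (rule order.trans[OF keys_pscale_subset keys_coord_sum])
    then have "fprod ?w = (\<Prod>a\<in>keys z. a powi \<lfloor>lookup ?w a\<rfloor>)"
      by (intro fprod_superset) auto
    moreover have "fprod ?w = 1" using n by (simp add: int_sums_def)
    ultimately have "(\<Sum>a\<in>keys z. of_int \<lfloor>lookup ?w a\<rfloor> * L a) = 0"
      using Lprod[OF z(2), of "\<lambda>a. \<lfloor>lookup ?w a\<rfloor>"] L1 by simp
    then have "of_nat n * (\<Sum>a\<in>keys z. lookup (coord_sum b z) a * L a) = 0"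
      unfolding int by (simp add: sum_distrib_left mult.assoc)
    then show ?thesis using n by simp
  qed
  have "(\<Sum>a\<in>keys z. lookup z a * L a) =
      (\<Sum>a\<in>keys z. \<Sum>b\<in>coord_support z. b * lookup (coord_sum b z) a * L a)"
    by (rule sum.cong[OF refl]) (subst lookup_coord_sum_eq, rule sum_distrib_right)
  also have "\<dots> = (\<Sum>b\<in>coord_support z. b * (\<Sum>a\<in>keys z. lookup (coord_sum b z) a * L a))"
    by (subst sum.swap) (simp add: sum_distrib_left mult.assoc)
  also have "\<dots> = 0" by (simp only: coord) simp
  finally show ?thesis .
qed

lemma floor_fraction_tendsto: "(\<lambda>n. of_int \<lfloor>real n * x\<rfloor> / real n) \<longlonglongrightarrow> x"
proof (rule LIMSEQ_I)
  fix e :: real assume e: "e > 0"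
  obtain N :: nat where N: "1 / e < real N" using reals_Archimedean2 by blast
  show "\<exists>N. \<forall>n\<ge>N. norm (of_int \<lfloor>real n * x\<rfloor> / real n - x) < e"
  proof (intro exI allI impI)
    fix n assume "n \<ge> Suc N"
    then have n: "real n > 0" "1 / e < real n" using N by auto
    have "\<bar>of_int \<lfloor>real n * x\<rfloor> - real n * x\<bar> \<le> 1" by linarith
    then have "\<bar>of_int \<lfloor>real n * x\<rfloor> - real n * x\<bar> / real n \<le> 1 / real n"
      using n by (simp add: divide_right_mono)
    moreover have "1 / real n < e" using n e by (simp add: field_simps)
    moreover have "\<bar>of_int \<lfloor>real n * x\<rfloor> / real n - x\<bar> = \<bar>of_int \<lfloor>real n * x\<rfloor> - real n * x\<bar> / real n"
      using n by (simp add: abs_divide field_simps flip: abs_divide)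
    ultimately show "norm (of_int \<lfloor>real n * x\<rfloor> / real n - x) < e" by simp
  qed
qed

text \<open>A positive real relation can be perturbed, in rational coordinates, to a positive integral
  one; and a product of elements of \<open>B\<close> is a unit only if all factors are.\<close>

lemma unit_relations_positive:
  assumes B: "1 \<in> B" "\<And>a b. a \<in> B \<Longrightarrow> b \<in> B \<Longrightarrow> a * b \<in> B"
    and z: "z \<in> unit_relations (runits B)" "keys z \<subseteq> B" "\<And>a. a \<in> keys z \<Longrightarrow> lookup z a > 0"
  shows "keys z \<subseteq> runits B"
proof -
  have H: "mult_subgroup (runits B)"
    using B by (auto simp: mult_subgroup_def runits_def)
  \<comment> \<open>Each basis element \<open>b\<close> is replaced by a rational number close to
    it. The finitely many coefficients converge to those of \<open>z\<close>, so for some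
    \<open>n\<close> all of them are positive.\<close>
  define r where "r n b = of_int \<lfloor>real n * b\<rfloor> / real n" for n b
  have "\<forall>\<^sub>F n in sequentially. \<forall>a\<in>keys z. (\<Sum>b\<in>coord_support z. r n b * lookup (coord_sum b z) a) > 0"
  proof (rule eventually_ball_finite; clarsimp?)
    fix a assume a: "a \<in> keys z"
    have "(\<lambda>n. \<Sum>b\<in>coord_support z. r n b * lookup (coord_sum b z) a)
      \<longlonglongrightarrow> (\<Sum>b\<in>coord_support z. b * lookup (coord_sum b z) a)"
      unfolding r_def by (intro tendsto_intros floor_fraction_tendsto)
    then have "(\<lambda>n. \<Sum>b\<in>coord_support z. r n b * lookup (coord_sum b z) a) \<longlonglongrightarrow> lookup z a"
      by (simp only: lookup_coord_sum_eq[of z a, symmetric])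
    then have "\<forall>\<^sub>F n in sequentially. (\<Sum>b\<in>coord_support z. r n b * lookup (coord_sum b z) a) > 0"
      using z(3)[OF a] by (rule order_tendstoD)
    then show "\<forall>\<^sub>F n in sequentially.
        0 < (\<Sum>b\<in>coord_support z. r n b * real_of_rat (rat_coord b (lookup z a)))" by simp
  qed
  from eventually_happens'[OF sequentially_bot this]
  obtain n where n: "\<forall>a\<in>keys z. (\<Sum>b\<in>coord_support z. r n b * lookup (coord_sum b z) a) > 0"
    by (elim exE)
  \<comment> \<open>With rational scalars \<open>r n b\<close> the coordinates combine to a rational
    relation; with the basis elements \<open>b\<close> themselves as scalars they would give back
    the real relation \<open>z\<close>.\<close>
  define w where "w = (\<Sum>b\<in>coord_support z. pscale (r n b) (coord_sum b z))"
  have lookup_w: "lookup w a = (\<Sum>b\<in>coord_support z. r n b * lookup (coord_sum b z) a)" for a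
    by (simp add: w_def lookup_sum)
  have "w \<in> rat_sums (runits B)"
    unfolding w_def r_def using H z(1)
    by (intro rat_sums_sum rat_sums_scale coord_sum_in_rat_sums) auto
  then obtain m :: nat where m: "m > 0" "pscale (of_nat m) w \<in> int_sums (runits B)"
    by (auto simp: rat_sums_def)
  \<comment> \<open>The exponents of the integral relation are positive, so the products below are
    formed inside \<open>B\<close>, which need not contain inverses.\<close>
  define k where "k a = nat \<lfloor>real m * lookup w a\<rfloor>" for a
  have pos: "\<lfloor>real m * lookup w a\<rfloor> > 0" if "a \<in> keys z" for a
  proof -
    have "real m * lookup w a > 0" using bspec[OF n that] m unfolding lookup_w by simp
    moreover have "of_int \<lfloor>real m * lookup w a\<rfloor> = real m * lookup w a"
      using m by (simp add: int_sums_def integral_sum_def of_int_floor)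
    ultimately show ?thesis by (metis of_int_0_less_iff)
  qed
  have "keys (pscale (of_nat m) w) \<subseteq> keys z"
    by (auto simp: Poly_Mapping.in_keys_iff lookup_w)
  then have "fprod (pscale (of_nat m) w) = (\<Prod>a\<in>keys z. a powi \<lfloor>real m * lookup w a\<rfloor>)"
    by (subst fprod_superset[of "keys z"]) auto
  also have "\<dots> = (\<Prod>a\<in>keys z. a ^ k a)"
    by (rule prod.cong[OF refl]) (use pos in \<open>force simp: power_int_def k_def\<close>)
  finally have unit: "(\<Prod>a\<in>keys z. a ^ k a) \<in> runits B"
    using m by (simp add: int_sums_def)
  have pow: "a ^ j \<in> B" if "a \<in> B" for a and j :: nat
    using that B by (induction j) auto
  have prod: "(\<Prod>a\<in>T. a ^ k a) \<in> B" if "T \<subseteq> B" for T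
    using that by (induction T rule: infinite_finite_induct) (auto intro: B pow)
  show ?thesis
  proof
    fix a assume a: "a \<in> keys z"
    then obtain j where j: "k a = Suc j"
      using pos[OF a] by (cases "k a") (auto simp: k_def)
    \<comment> \<open>The cofactor of one factor \<open>a\<close> of the unit. Since
      \<open>c\<close> lies in \<open>B\<close>, so does \<open>c * inverse (a * c)\<close>, which
      is the inverse of \<open>a\<close>.\<close>
    define c where "c = a ^ j * (\<Prod>b\<in>keys z - {a}. b ^ k b)"
    have ac: "a * c \<in> runits B"
      using unit by (simp add: prod.remove[OF _ a] j c_def mult.assoc)
    have c: "c \<in> B" using a z(2) by (auto simp: c_def intro!: B(2) pow prod)
    have nz: "a * c \<noteq> 0" and inv: "inverse (a * c) \<in> B" using ac by (auto simp: runits_def simp del: inverse_mult_distrib)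
    have "c * inverse (a * c) = (c * inverse c) * inverse a"
      by (simp add: ac_simps)
    also have "\<dots> = inverse a" using nz by simp
    finally have "inverse a \<in> B" using B(2)[OF c inv] by (simp only:)
    then show "a \<in> runits B"
      using a z(2) nz by (auto simp: runits_def)
  qed
qed


section \<open>Cartier divisors on families of local rings\<close>

text \<open>Closure under products together with 1 makes \<open>runits A\<close> a multiplicative
  group. The notion applies alike to a scheme, an open subset, a model and a single local
  ring.\<close>

definition mult_rings :: "'f::field set set \<Rightarrow> bool" where
  "mult_rings Xs \<longleftrightarrow> (\<forall>A\<in>Xs. 1 \<in> A \<and> (\<forall>a\<in>A. \<forall>b\<in>A. a * b \<in> A))"

lemma mult_rings_subset: "mult_rings Xs \<Longrightarrow> U \<subseteq> Xs \<Longrightarrow> mult_rings U"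
  by (auto simp: mult_rings_def)

lemma mult_subgroup_runits: "mult_rings Xs \<Longrightarrow> A \<in> Xs \<Longrightarrow> mult_subgroup (runits A)"
  by (auto simp: mult_rings_def mult_subgroup_def runits_def)

text \<open>Primality of \<open>P\<close> keeps the denominators closed under products, and
  properness puts 1 among them.\<close>

lemma mult_rings_affine_points: "mult_rings (affine_points A)"
  unfolding mult_rings_def
proof (intro ballI conjI)
  fix S assume "S \<in> affine_points A"
  then obtain P where P: "primeideal P (ring_on A)" and S: "S = localization A P"
    by (auto simp: affine_points_def)
  interpret primeideal P "ring_on A" by (rule P)
  have A: "1 \<in> A" "\<And>a b. a \<in> A \<Longrightarrow> b \<in> A \<Longrightarrow> a * b \<in> A"
    using one_closed m_closed by (auto simp: ring_of_type_algebra_def)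
  have "1 \<notin> P"
    using one_imp_carrier I_notcarr by (auto simp: ring_of_type_algebra_def)
  with A show "1 \<in> S" unfolding S localization_def
    by (intro CollectI exI[of _ 1]) auto
  have prime: "a \<in> P \<or> b \<in> P" if "a \<in> A" "b \<in> A" "a * b \<in> P" for a b
    using I_prime[of a b] that by (auto simp: ring_of_type_algebra_def)
  fix x y assume "x \<in> S" "y \<in> S"
  then obtain a b c d where "x = a / b" "a \<in> A" "b \<in> A - P" "y = c / d" "c \<in> A" "d \<in> A - P"
    by (auto simp: S localization_def)
  then show "x * y \<in> S"
    using A prime unfolding S localization_def
    by (intro CollectI exI[of _ "a * c"] exI[of _ "b * d"]) auto
qed

lemma projective_integral_mult_rings: "projective_integral \<iota> R Xs \<Longrightarrow> mult_rings Xs"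
  using mult_rings_affine_points unfolding projective_integral_def mult_rings_def by fast

lemma topspace_zariski: "mult_rings Xs \<Longrightarrow> topspace (zariski Xs) = Xs"
  by (auto simp: zariski_def mult_rings_def)

lemma openin_zariski_domain: "openin (zariski Xs) {A \<in> Xs. f \<in> A}"
  unfolding zariski_def by (rule topology_generated_by_Basis) auto

lemma openin_zariski_subset: "mult_rings Xs \<Longrightarrow> openin (zariski Xs) U \<Longrightarrow> U \<subseteq> Xs"
  using openin_subset topspace_zariski by metis

text \<open>Here \<open>U\<close> is any subset of \<open>Y\<close>: the inclusion is continuous
  because the domain of a function pulls back to the domain of the same function. This covers a
  single point and the generic fibre of a model.\<close>

lemma openin_zariski_restrict:
  assumes "openin (zariski Y) V" "U \<subseteq> Y"
  shows "openin (zariski U) (V \<inter> U)"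
proof -
  have "continuous_map (zariski U) (zariski Y) id"
    unfolding zariski_def[of Y]
  proof (rule continuous_on_generated_topo)
    fix S assume "S \<in> range (\<lambda>f. {A \<in> Y. f \<in> A})"
    then obtain f where "S = {A \<in> Y. f \<in> A}" by auto
    then have "id -` S \<inter> topspace (zariski U) = {A \<in> U. f \<in> A}"
      using assms(2) openin_subset[OF openin_zariski_domain[of U f]]
        openin_subset[OF openin_topspace[of "zariski U"]] by (auto simp: zariski_def)
    then show "openin (zariski U) (id -` S \<inter> topspace (zariski U))"
      by (simp add: openin_zariski_domain)
  qed (use assms(2) in \<open>auto simp: zariski_def\<close>)
  then have "openin (zariski U) {x \<in> topspace (zariski U). x \<in> V}"
    using assms(1) openin_continuous_map_preimage by fastforce
  moreover have "{x \<in> topspace (zariski U). x \<in> V} = V \<inter> U"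
    using assms openin_subset[OF assms(1)] by (auto simp: zariski_def)
  ultimately show ?thesis by simp
qed

section \<open>Restriction of divisors and principal divisors\<close>

definition restr :: "'f set set \<Rightarrow> 'f cdiv \<Rightarrow> 'f cdiv" where
  "restr U = (\<lambda>E A. if A \<in> U then E A else {})"

lemma restrict_rdiv_eq: "restrict_rdiv U D = rt_map (cartier U) (restr U) D"
  by (simp add: restrict_rdiv_def restr_def)

lemma principal_cdiv_hom:
  assumes "mult_rings Xs"
  shows "principal_cdiv Xs \<in> hom rat_group (cartier Xs)"
proof (rule homI)
  fix a :: 'a assume "a \<in> carrier rat_group"
  then have "a \<noteq> 0" by (simp add: rat_group_def)
  then show "principal_cdiv Xs a \<in> carrier (cartier Xs)"
    using openin_topspace[of "zariski Xs"] topspace_zariski[OF assms]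
    by (auto simp: cartier_def principal_cdiv_def)
next
  fix a b :: 'a
  have "(\<lambda>u. a * b * u) ` runits A = {x * y | x y. x \<in> (\<lambda>u. a * u) ` runits A \<and> y \<in> (\<lambda>u. b * u) ` runits A}"
    if "A \<in> Xs" for A
  proof -
    have H: "1 \<in> runits A" "\<And>u v. u \<in> runits A \<Longrightarrow> v \<in> runits A \<Longrightarrow> u * v \<in> runits A"
      using mult_subgroup_runits[OF assms that] by (auto simp: mult_subgroup_def)
    show ?thesis
    proof (intro equalityI subsetI)
      fix t assume "t \<in> (\<lambda>u. a * b * u) ` runits A"
      then obtain u where "u \<in> runits A" "t = (a * u) * (b * 1)" by auto
      with H show "t \<in> {x * y | x y. x \<in> (\<lambda>u. a * u) ` runits A \<and> y \<in> (\<lambda>u. b * u) ` runits A}"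
        by blast
    next
      fix t assume "t \<in> {x * y | x y. x \<in> (\<lambda>u. a * u) ` runits A \<and> y \<in> (\<lambda>u. b * u) ` runits A}"
      then obtain u v where "u \<in> runits A" "v \<in> runits A" "t = a * b * (u * v)"
        by (auto simp: ac_simps)
      with H show "t \<in> (\<lambda>u. a * b * u) ` runits A" by blast
    qed
  qed
  then show "principal_cdiv Xs (a \<otimes>\<^bsub>rat_group\<^esub> b) = principal_cdiv Xs a \<otimes>\<^bsub>cartier Xs\<^esub> principal_cdiv Xs b"
    by (auto simp: cartier_def rat_group_def principal_cdiv_def fun_eq_iff)
qed

lemma restr_hom:
  assumes "U \<subseteq> Y"
  shows "restr U \<in> hom (cartier Y) (cartier U)"
proof (rule homI)
  fix E assume E: "E \<in> carrier (cartier Y)"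
  show "restr U E \<in> carrier (cartier U)"
    unfolding cartier_def partial_object.simps mem_Collect_eq
  proof (intro conjI ballI allI impI)
    fix A assume A: "A \<in> U"
    then obtain W a where W: "openin (zariski Y) W" "A \<in> W" "a \<noteq> 0"
      "\<forall>B\<in>W. E B = principal_cdiv Y a B"
      using E assms unfolding cartier_def by (simp add: subset_iff) meson
    have "openin (zariski U) (W \<inter> U)"
      using openin_zariski_restrict[OF W(1) assms] .
    moreover have "\<forall>B\<in>W \<inter> U. restr U E B = principal_cdiv U a B"
      using W assms by (auto simp: restr_def principal_cdiv_def)
    ultimately show "\<exists>W a. openin (zariski U) W \<and> A \<in> W \<and> a \<noteq> 0 \<and>
        (\<forall>B\<in>W. restr U E B = principal_cdiv U a B)"
      using W A by blast
  qed (simp add: restr_def)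
next
  fix E F
  show "restr U (E \<otimes>\<^bsub>cartier Y\<^esub> F) = restr U E \<otimes>\<^bsub>cartier U\<^esub> restr U F"
    by (auto simp: cartier_def restr_def fun_eq_iff)
qed

lemma restr_principal: "U \<subseteq> Xs \<Longrightarrow> restr U \<circ> principal_cdiv Xs = principal_cdiv U"
  by (auto simp: restr_def principal_cdiv_def fun_eq_iff)

lemma principal_rdiv_in: "mult_rings Xs \<Longrightarrow> \<phi> \<in> rat_R \<Longrightarrow> principal_rdiv Xs \<phi> \<in> div_R Xs"
  unfolding principal_rdiv_def by (rule rt_map_in[OF principal_cdiv_hom])

lemma restrict_principal_rdiv:
  assumes "mult_rings Xs" "U \<subseteq> Xs" "\<phi> \<in> rat_R"
  shows "restrict_rdiv U (principal_rdiv Xs \<phi>) = principal_rdiv U \<phi>"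
  unfolding restrict_rdiv_eq principal_rdiv_def using assms
  by (subst rt_map_rt_map[OF principal_cdiv_hom restr_hom])
    (auto simp: restr_principal intro: principal_cdiv_hom mult_rings_subset)

lemma restrict_rdiv_zero: "U \<subseteq> Xs \<Longrightarrow> restrict_rdiv U (rclass (cartier Xs) 0) = rclass (cartier U) 0"
  unfolding restrict_rdiv_eq by (rule rt_map_zero[OF restr_hom])

lemma not_in_Supp_iff:
  "A \<in> Xs \<Longrightarrow> A \<notin> Supp Xs D \<longleftrightarrow> restrict_rdiv {A} D = rclass (cartier {A}) 0"
  by (simp add: Supp_def)

lemma Supp_zero [simp]: "Supp Xs (rclass (cartier Xs) 0) = {}"
  by (auto simp: Supp_def restrict_rdiv_zero)

lemma Supp_scale: "D \<in> div_R Xs \<Longrightarrow> r \<noteq> 0 \<Longrightarrow> Supp Xs (rt_scale (cartier Xs) r D) = Supp Xs D"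
  unfolding Supp_def restrict_rdiv_eq
  by (rule Collect_cong)
    (auto simp: rt_map_scale[OF restr_hom] rt_scale_eq_zero_iff[OF rt_map_in[OF restr_hom]]
      rt_scale_zero_class)

text \<open>At \<open>A\<close> the divisor \<open>D\<close> restricts to zero, so \<open>E\<close>
  and the sum have the same restriction.\<close>

lemma Supp_add_iff:
  assumes "A \<in> Xs" "D \<in> div_R Xs" "E \<in> div_R Xs" "A \<notin> Supp Xs D"
  shows "A \<in> Supp Xs (rt_add (cartier Xs) D E) \<longleftrightarrow> A \<in> Supp Xs E"
proof -
  have "{A} \<subseteq> Xs" using assms(1) by simp
  from restr_hom[OF this] show ?thesis
    using assms unfolding Supp_def restrict_rdiv_eq
    by (simp add: rt_map_add rt_add_zero_left rt_map_in)
qed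

lemma principal_rdiv_scale:
  "mult_rings Xs \<Longrightarrow> \<phi> \<in> rat_R \<Longrightarrow>
   principal_rdiv Xs (rt_scale rat_group r \<phi>) = rt_scale (cartier Xs) r (principal_rdiv Xs \<phi>)"
  unfolding principal_rdiv_def by (rule rt_map_scale[OF principal_cdiv_hom])


subsection \<open>Real divisors at a point\<close>

lemma principal_cdiv_unit:
  assumes "mult_rings {B}" "u \<in> runits B"
  shows "principal_cdiv {B} u = principal_cdiv {B} 1"
proof -
  have H: "mult_subgroup (runits B)" using assms mult_subgroup_runits by blast
  have "(\<lambda>v. u * v) ` runits B = runits B"
  proof (intro equalityI subsetI)
    fix v assume "v \<in> runits B"
    moreover have "v = u * (inverse u * v)" using assms(2) by (simp add: runits_def)
    ultimately show "v \<in> (\<lambda>v. u * v) ` runits B"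
      using H assms(2) unfolding mult_subgroup_def by blast
  qed (use H assms(2) in \<open>auto simp: mult_subgroup_def\<close>)
  then show ?thesis by (simp add: principal_cdiv_def fun_eq_iff)
qed

text \<open>Units have the identity \<open>e\<close> as divisor, and \<open>e\<close> is trivial in
  the tensor product because \<open>e * e = e\<close> yields the relation
  \<open>[e] - [e] - [e]\<close>.\<close>

lemma push_principal_unit:
  assumes B: "mult_rings {B}" and z: "keys z \<subseteq> runits B"
  shows "push (principal_cdiv {B}) z \<in> sum_relations (cartier {B})"
proof -
  let ?e = "principal_cdiv {B} 1"
  have "?e \<otimes>\<^bsub>cartier {B}\<^esub> ?e = principal_cdiv {B} (1 \<otimes>\<^bsub>rat_group\<^esub> 1)"
    by (rule hom_mult[OF principal_cdiv_hom[OF B], symmetric]) (simp_all add: rat_group_def)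
  also have "\<dots> = ?e" by (simp add: rat_group_def)
  finally have e: "?e \<otimes>\<^bsub>cartier {B}\<^esub> ?e = ?e" .
  have "?e \<in> carrier (cartier {B})"
    using principal_cdiv_hom[OF B] by (rule hom_in_carrier) (simp add: rat_group_def)
  from sum_relations_base[OF this this] have "- single ?e (1::real) \<in> sum_relations (cartier {B})"
    by (simp add: e)
  then have single: "single ?e x \<in> sum_relations (cartier {B})" for x
    using sum_relations_scale[of "- single ?e 1" "cartier {B}" "- x"]
    by (simp add: pscale_single single_uminus)
  have "push (principal_cdiv {B}) z = (\<Sum>a\<in>keys z. single ?e (lookup z a))"
    unfolding push_def using z principal_cdiv_unit[OF B] by (intro sum.cong) auto
  also have "\<dots> \<in> sum_relations (cartier {B})"
    by (intro fs.subspace_sum sum_relations_subspace single)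
  finally show ?thesis .
qed

lemma coset_in_unit_relations:
  assumes "a \<noteq> 0" "u \<in> runits B"
  shows "single (a * u) 1 - single a 1 \<in> unit_relations (runits B)"
proof -
  have "u \<noteq> 0" using assms by (simp add: runits_def)
  from unit_relations_add[OF mult_in_unit_relations[OF assms(1) this] single_in_unit_relations[OF assms(2)]]
  show ?thesis by simp
qed

text \<open>Choosing generators of the cosets maps the relations between divisors at the point \<open>B\<close> to
  relations in \<open>F\<^sup>\<times>\<close> modulo \<open>B\<^sup>\<times>\<close>.\<close>

lemma push_principal_relations:
  assumes B: "mult_rings {B}" and z: "z \<in> formal_sums rat_group"
    and rel: "push (principal_cdiv {B}) z \<in> sum_relations (cartier {B})"
  shows "z \<in> unit_relations (runits B)"
proof -
  let ?U = "unit_relations (runits B)"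
  \<comment> \<open>A choice of generator in each coset is a homomorphism only up to units of
    \<open>B\<close>, which is why images of relations land in \<open>unit_relations\<close> rather
    than in \<open>sum_relations\<close>.\<close>
  define c where "c E = (SOME a. a \<in> E B)" for E :: "'a cdiv"
  have H: "1 \<in> runits B" "\<And>u v. u \<in> runits B \<Longrightarrow> v \<in> runits B \<Longrightarrow> u * v \<in> runits B"
    using mult_subgroup_runits[OF B, of B] by (auto simp: mult_subgroup_def)
  have c_in: "c E \<in> E B" if "a \<in> E B" for E a
    unfolding c_def using that by (rule someI)
  have c_coset: "\<exists>u\<in>runits B. c E = a * u" if "E B = (\<lambda>u. a * u) ` runits B" for E a
  proof -
    have "a * 1 \<in> E B" unfolding that using H(1) by blast
    from c_in[of "a * 1" E, OF this] show ?thesis unfolding that by blast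
  qed
  have carrier: "\<exists>a. a \<noteq> 0 \<and> E B = (\<lambda>u. a * u) ` runits B" if "E \<in> carrier (cartier {B})" for E
    using that unfolding cartier_def principal_cdiv_def by auto
  have c_nz: "c E \<noteq> 0" if E: "E \<in> carrier (cartier {B})" for E
  proof -
    obtain a where a: "a \<noteq> 0" "E B = (\<lambda>u. a * u) ` runits B" using carrier[OF E] by auto
    obtain u where "u \<in> runits B" "c E = a * u" using c_coset[of E a, OF a(2)] by auto
    with a show ?thesis by (simp add: runits_def)
  qed
  have push_c: "push c y \<in> ?U" if "y \<in> sum_relations (cartier {B})" for y
    using that unfolding sum_relations_def
  proof (induction rule: fs.span_induct_alt)
    case base
    show ?case by (simp add: unit_relations_zero)
  next
    case (step r x y)
    from step(1) obtain E F where EF: "E \<in> carrier (cartier {B})" "F \<in> carrier (cartier {B})"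
      and x: "x = single (E \<otimes>\<^bsub>cartier {B}\<^esub> F) 1 - single E 1 - single F 1" by auto
    let ?G = "E \<otimes>\<^bsub>cartier {B}\<^esub> F"
    obtain a where a: "a \<noteq> 0" "E B = (\<lambda>u. a * u) ` runits B" using carrier[OF EF(1)] by auto
    obtain b where b: "b \<noteq> 0" "F B = (\<lambda>u. b * u) ` runits B" using carrier[OF EF(2)] by auto
    obtain u where u: "u \<in> runits B" "c E = a * u" using c_coset[of E a, OF a(2)] by auto
    obtain v where v: "v \<in> runits B" "c F = b * v" using c_coset[of F b, OF b(2)] by auto
    have G: "?G B = {s * t | s t. s \<in> E B \<and> t \<in> F B}" by (simp add: cartier_def)
    have "a * 1 \<in> E B" "b * 1 \<in> F B" unfolding a(2) b(2) using H(1) by blast+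
    then have "(a * 1) * (b * 1) \<in> ?G B" unfolding G by blast
    from c_in[of _ ?G, OF this] obtain s t where "s \<in> E B" "t \<in> F B" "c ?G = s * t"
      unfolding G by blast
    with a b obtain s t where st: "s \<in> runits B" "t \<in> runits B" "c ?G = (a * s) * (b * t)" by auto
    have nz: "a * b \<noteq> 0" using a b by simp
    have d1: "single (c ?G) 1 - single (a * b) 1 \<in> ?U"
      using coset_in_unit_relations[OF nz H(2)[OF st(1,2)]] by (simp add: st(3) ac_simps)
    have d2: "single (c E) 1 - single a 1 \<in> ?U" and d3: "single (c F) 1 - single b 1 \<in> ?U"
      using coset_in_unit_relations a(1) b(1) u v by simp_all
    have d4: "single (a * b) 1 - single a 1 - single b 1 \<in> ?U"
      using mult_in_unit_relations a(1) b(1) .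
    \<comment> \<open>The reference generators \<open>a * b\<close>, \<open>a\<close> and
      \<open>b\<close> cancel, leaving exactly \<open>push c x\<close>.\<close>
    note unit_relations_add[OF unit_relations_diff[OF unit_relations_diff[OF d1 d2] d3] d4]
    then have "push c x \<in> ?U" by (simp add: x push_diff push_add algebra_simps)
    with step(2) show ?case by (simp add: push_add push_pscale unit_relations_add unit_relations_scale)
  qed
  have diff: "single (c (principal_cdiv {B} a)) 1 - single a 1 \<in> ?U" if "a \<in> keys z" for a
  proof -
    have "a \<noteq> 0" using that z by (auto simp: formal_sums_def rat_group_def)
    moreover obtain u where "u \<in> runits B" "c (principal_cdiv {B} a) = a * u"
      using c_coset[of "principal_cdiv {B} a" a] by (auto simp: principal_cdiv_def)
    ultimately show ?thesis using coset_in_unit_relations by simp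
  qed
  \<comment> \<open>Passing to cosets and then choosing generators changes each key by a unit only,
    so it is the identity modulo \<open>unit_relations\<close>.\<close>
  have "push c (push (principal_cdiv {B}) z) - z =
    (\<Sum>a\<in>keys z. pscale (lookup z a) (single (c (principal_cdiv {B} a)) 1 - single a 1))"
  proof -
    have "push c (push (principal_cdiv {B}) z) = (\<Sum>a\<in>keys z. single (c (principal_cdiv {B} a)) (lookup z a))"
      by (simp only: push_push) (simp add: push_def)
    moreover have "(\<Sum>a\<in>keys z. single a (lookup z a)) = z"
      using poly_mapping_sum_single[of z] by (simp add: pscale_single)
    ultimately show ?thesis
      by (simp add: fs.scale_right_diff_distrib pscale_single sum_subtractf)
  qed
  also have "\<dots> \<in> ?U"
    by (intro unit_relations_sum unit_relations_scale diff)
  finally have "push c (push (principal_cdiv {B}) z) - z \<in> ?U" .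
  from unit_relations_diff[OF push_c[OF rel] this] show ?thesis by simp
qed

text \<open>Vanishing of the divisor at \<open>B\<close> says that any representative of
  \<open>\<phi>\<close> is a relation modulo units, so its class also has a representative by units.
  On such representatives \<open>log_abs\<close> is evaluated.\<close>

lemma unit_representative:
  assumes B: "mult_rings {B}" and \<phi>: "\<phi> \<in> rat_R" and zero: "principal_rdiv {B} \<phi> = rclass (cartier {B}) 0"
  obtains z where "z \<in> \<phi>" "keys z \<subseteq> runits B"
proof -
  obtain z0 where z0: "z0 \<in> formal_sums rat_group" "\<phi> = rclass rat_group z0"
    using \<phi> by (rule real_tensor_cases)
  note hom = principal_cdiv_hom[OF B]
  have "push (principal_cdiv {B}) z0 \<in> sum_relations (cartier {B})"
    using zero z0 by (simp add: principal_rdiv_def rt_map_rclass[OF hom] rclass_eq_iff push_formal_sums[OF hom])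
  then have "z0 \<in> unit_relations (runits B)"
    using push_principal_relations B z0(1) by blast
  then obtain z where z: "keys z \<subseteq> runits B" "z0 - z \<in> sum_relations rat_group"
    by (rule unit_relations_representative)
  then have "z \<in> \<phi>"
    using z0 sum_relations_minus_commute[of z z0 rat_group]
    by (auto simp: rclass_def formal_sums_def rat_group_def runits_def)
  with z that show ?thesis by blast
qed

lemma unit_representative_off_Supp:
  assumes "mult_rings Xs" "A \<in> Xs" "\<phi> \<in> rat_R" "A \<notin> Supp Xs (principal_rdiv Xs \<phi>)"
  obtains z where "z \<in> \<phi>" "keys z \<subseteq> runits A"
proof -
  have A: "{A} \<subseteq> Xs" using assms by simp
  have "principal_rdiv {A} \<phi> = rclass (cartier {A}) 0"
    using assms not_in_Supp_iff[OF assms(2)] restrict_principal_rdiv[OF assms(1) A assms(3)] by simp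
  with unit_representative[OF mult_rings_subset[OF assms(1) A] assms(3)] that show ?thesis by blast
qed

lemma unit_representative_local:
  assumes "mult_rings Xs" "U \<subseteq> Xs" "local_equation (rclass (cartier Xs) 0) U \<phi>" "A \<in> U"
  obtains z where "z \<in> \<phi>" "keys z \<subseteq> runits A"
proof -
  have U: "mult_rings U" using assms mult_rings_subset by blast
  have "principal_rdiv U \<phi> = rclass (cartier U) 0" and \<phi>: "\<phi> \<in> rat_R"
    using assms by (auto simp: local_equation_def restrict_rdiv_zero)
  then have "A \<notin> Supp U (principal_rdiv U \<phi>)" by simp
  with unit_representative_off_Supp[OF U assms(4) \<phi>] that show ?thesis by blast
qed

text \<open>\<open>E\<close> is a positive combination of effective Cartier divisors, each principal
  near \<open>A\<close>; their generators lie in \<open>A\<close> by effectivity and form the keys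
  of \<open>z\<close>. The last clause is where positivity enters: the components cannot cancel, so
  the real divisor is trivial at \<open>B\<close> only if every single generator is a unit
  there.\<close>

lemma effective_local_equation:
  assumes Xs: "mult_rings Xs" and E: "effective_rdiv Xs E" and A: "A \<in> Xs"
  obtains U z where "openin (zariski Xs) U" "A \<in> U" "local_equation E U (rclass rat_group z)"
    "finite (keys z)" "keys z \<subseteq> A" "\<And>a. a \<in> keys z \<Longrightarrow> lookup z a > 0"
    "\<And>B. B \<in> U \<Longrightarrow> keys z \<subseteq> B \<Longrightarrow> B \<notin> Supp Xs E \<longleftrightarrow> keys z \<subseteq> runits B"
proof -
  obtain y where y: "E = rclass (cartier Xs) y"
    "\<And>e. e \<in> keys y \<Longrightarrow> effective_cdiv Xs e \<and> lookup y e \<ge> 0"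
    using E by (auto simp: effective_rdiv_def)
  have y_formal: "y \<in> formal_sums (cartier Xs)"
    using y(2) by (auto simp: formal_sums_def effective_cdiv_def)
  have pos: "lookup y e > 0" if "e \<in> keys y" for e
    using y(2)[OF that] that by (auto simp: Poly_Mapping.in_keys_iff)
  have "\<exists>W a. openin (zariski Xs) W \<and> A \<in> W \<and> a \<noteq> 0 \<and> (\<forall>B\<in>W. e B = principal_cdiv Xs a B)"
    if "e \<in> keys y" for e
    using y(2)[OF that] A by (simp add: effective_cdiv_def cartier_def)
  then obtain W c where W: "\<And>e. e \<in> keys y \<Longrightarrow> openin (zariski Xs) (W e)"
      "\<And>e. e \<in> keys y \<Longrightarrow> A \<in> W e" "\<And>e. e \<in> keys y \<Longrightarrow> c e \<noteq> 0"
      "\<And>e B. e \<in> keys y \<Longrightarrow> B \<in> W e \<Longrightarrow> e B = principal_cdiv Xs (c e) B"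
    by metis
  define U where "U = Xs \<inter> (\<Inter>e\<in>keys y. W e)"
  have "openin (zariski Xs) (topspace (zariski Xs) \<inter> \<Inter> (W ` keys y))"
    by (rule openin_Int_Inter) (auto intro: W)
  then have U: "openin (zariski Xs) U"
    by (simp add: U_def topspace_zariski[OF Xs])
  have AU: "A \<in> U" and UXs: "U \<subseteq> Xs" using A W(2) by (auto simp: U_def)
  define z where "z = push c y"
  \<comment> \<open>Distinct components may share a generator; their positive coefficients then add
    up, so every generator remains a key.\<close>
  have keys: "keys z = c ` keys y" unfolding z_def using pos by (rule keys_push_pos)
  have z_formal: "z \<in> formal_sums rat_group"
    using W(3) by (auto simp: formal_sums_def keys rat_group_def)
  have rep: "c e \<in> A" if "e \<in> keys y" for e
  proof -
    have "1 \<in> runits A" using Xs A by (simp add: mult_rings_def runits_def)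
    then have "c e * 1 \<in> e A"
      using W(4)[OF that W(2)[OF that]] A by (auto simp: principal_cdiv_def)
    then show ?thesis using y(2)[OF that] A by (auto simp: effective_cdiv_def)
  qed
  \<comment> \<open>On subsets of the common neighbourhood each component \<open>e\<close> is the
    principal divisor of \<open>c e\<close>, so the two formal sums agree even before passing to
    classes.\<close>
  have push_eq: "push (restr S) y = push (principal_cdiv S) z" if "S \<subseteq> U" for S
    unfolding z_def push_push
  proof (rule push_cong, rule ext)
    fix e B assume "e \<in> keys y"
    moreover from this have "B \<in> S \<Longrightarrow> e B = principal_cdiv Xs (c e) B \<and> B \<in> Xs"
      using W(4)[of e B] that by (auto simp: U_def)
    ultimately show "restr S e B = (principal_cdiv S \<circ> c) e B"
      by (auto simp: restr_def principal_cdiv_def)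
  qed
  have restrict: "restrict_rdiv S E = principal_rdiv S (rclass rat_group z)" if "S \<subseteq> U" for S
  proof -
    have "S \<subseteq> Xs" using that UXs by auto
    then show ?thesis
      unfolding restrict_rdiv_eq principal_rdiv_def y(1)
      by (simp add: rt_map_rclass[OF restr_hom _] rt_map_rclass[OF principal_cdiv_hom]
          y_formal z_formal mult_rings_subset[OF Xs] push_eq[OF that])
  qed
  have supp: "B \<notin> Supp Xs E \<longleftrightarrow> keys z \<subseteq> runits B" if "B \<in> U" "keys z \<subseteq> B" for B
  proof -
    have BXs: "B \<in> Xs" and B: "mult_rings {B}" and BU: "{B} \<subseteq> U"
      using that UXs mult_rings_subset[OF Xs, of "{B}"] by auto
    note hom = principal_cdiv_hom[OF B]
    have "B \<notin> Supp Xs E \<longleftrightarrow> push (principal_cdiv {B}) z \<in> sum_relations (cartier {B})"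
      unfolding not_in_Supp_iff[OF BXs] restrict[OF BU] principal_rdiv_def rt_map_rclass[OF hom z_formal]
      by (simp add: rclass_eq_iff[OF push_formal_sums[OF hom z_formal]])
    also have "\<dots> \<longleftrightarrow> keys z \<subseteq> runits B"
    proof
      assume "push (principal_cdiv {B}) z \<in> sum_relations (cartier {B})"
      then have "z \<in> unit_relations (runits B)"
        by (rule push_principal_relations[OF B z_formal])
      then show "keys z \<subseteq> runits B"
        using B that lookup_push_pos[of y _ c, OF pos]
        by (intro unit_relations_positive) (auto simp: mult_rings_def z_def)
    qed (rule push_principal_unit[OF B])
    finally show ?thesis .
  qed
  show ?thesis
  proof (rule that[of U z])
    show "local_equation E U (rclass rat_group z)"
      using restrict[of U] rclass_in[OF z_formal] by (simp add: local_equation_def)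
    show "lookup z a > 0" if "a \<in> keys z" for a
      using lookup_push_pos[of y a c] pos that unfolding z_def by blast
  qed (use U AU rep supp keys in auto)
qed


section \<open>Points of the analytification\<close>

lemma one_in_cauchy_seqs: "1 \<in> cauchy_seqs p"
  by (simp add: cauchy_seqs_def abs_at_def)

text \<open>The space of a generated topology is the union of its subbasis. The sum 0 has no keys,
  so together with \<open>UNIV\<close> it gives a subbasic set containing every point.\<close>

lemma topspace_an_Fin: "an \<iota> Xs (Fin p) = berkovich_points \<iota> Xs p"
proof (intro equalityI subsetI)
  let ?S = "\<lambda>z W. {NPoint A N | A N. NPoint A N \<in> berkovich_points \<iota> Xs p \<and>
      keys z \<subseteq> A \<times> cauchy_seqs p \<and> N z \<in> W}"
  fix x assume x: "x \<in> berkovich_points \<iota> Xs p"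
  then obtain A N where "x = NPoint A N" by (auto simp: berkovich_points_def)
  with x have "x \<in> ?S 0 UNIV" by simp
  moreover have "openin (an_top \<iota> Xs (Fin p)) (?S 0 UNIV)"
    unfolding an_top.simps by (intro topology_generated_by_Basis) blast
  ultimately show "x \<in> an \<iota> Xs (Fin p)" using openin_subset by blast
qed auto

lemma topspace_an_Emb:
  assumes "mult_rings Xs"
  shows "an \<iota> Xs (Emb \<sigma>) = complex_points \<iota> Xs \<sigma>"
proof (intro equalityI subsetI)
  let ?S = "\<lambda>f W. {CPoint A h | A h. CPoint A h \<in> complex_points \<iota> Xs \<sigma> \<and> f \<in> A \<and> h f \<in> W}"
  fix x assume x: "x \<in> complex_points \<iota> Xs \<sigma>"
  then obtain A h where "x = CPoint A h" "A \<in> Xs" by (auto simp: complex_points_def)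
  with x assms have "x \<in> ?S 1 UNIV" by (simp add: mult_rings_def)
  moreover have "openin (an_top \<iota> Xs (Emb \<sigma>)) (?S 1 UNIV)"
    unfolding an_top.simps by (intro topology_generated_by_Basis) blast
  ultimately show "x \<in> an \<iota> Xs (Emb \<sigma>)" using openin_subset by blast
qed auto

lemma local_ring_in:
  assumes "mult_rings Xs" "x \<in> an \<iota> Xs v"
  shows "local_ring x \<in> Xs"
proof (cases v)
  case (Fin p)
  with assms have "x \<in> berkovich_points \<iota> Xs p" using topspace_an_Fin by metis
  then show ?thesis by (auto simp: berkovich_points_def)
next
  case (Emb \<sigma>)
  with assms have "x \<in> complex_points \<iota> Xs \<sigma>" using topspace_an_Emb by metis
  then show ?thesis by (auto simp: complex_points_def)
qed

text \<open>The common features of Berkovich and complex points: a multiplicative absolute value on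
  the local ring that vanishes exactly at the nonunits. It lets both kinds of places be treated
  together.\<close>

definition abs_point :: "('k::field, 'f::field) point \<Rightarrow> bool" where
  "abs_point x \<longleftrightarrow> mult_rings {local_ring x} \<and>
     (\<forall>a\<in>local_ring x. \<forall>b\<in>local_ring x. pabs x (a * b) = pabs x a * pabs x b) \<and>
     (\<forall>a\<in>local_ring x. 0 \<le> pabs x a \<and> (pabs x a = 0 \<longleftrightarrow> a \<notin> runits (local_ring x)))"

lemma abs_point_an:
  assumes Xs: "mult_rings Xs" and x: "x \<in> an \<iota> Xs v"
  shows "abs_point x"
proof -
  have A: "mult_rings {local_ring x}"
    using mult_rings_subset[OF Xs] local_ring_in[OF Xs x] by simp
  show ?thesis
  proof (cases v)
    case (Fin p)
    with x have "x \<in> berkovich_points \<iota> Xs p" using topspace_an_Fin by metis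
    then obtain A N where N: "x = NPoint A N"
      "\<forall>z\<in>{z. keys z \<subseteq> A \<times> cauchy_seqs p}. N z \<ge> 0"
      "\<forall>z\<in>{z. keys z \<subseteq> A \<times> cauchy_seqs p}. \<forall>w\<in>{z. keys z \<subseteq> A \<times> cauchy_seqs p}.
         N (pair_prod z w) = N z * N w"
      "\<forall>f\<in>A. N (frag_of (f, 1)) = 0 \<longleftrightarrow> f \<notin> runits A"
      unfolding berkovich_points_def Let_def by (elim CollectE exE conjE)
    have k: "frag_of (a, 1) \<in> {z. keys z \<subseteq> A \<times> cauchy_seqs p}" if "a \<in> A" for a
      using that one_in_cauchy_seqs by simp
    have "N (frag_of (a * b, 1)) = N (frag_of (a, 1)) * N (frag_of (b, 1))" if "a \<in> A" "b \<in> A" for a b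
      using bspec[OF bspec[OF N(3) k[OF that(1)]] k[OF that(2)]] by (simp add: pair_prod_def)
    then show ?thesis
      using A bspec[OF N(2) k] N(4) by (simp add: abs_point_def N(1))
  next
    case (Emb \<sigma>)
    with assms have "x \<in> complex_points \<iota> Xs \<sigma>" using topspace_an_Emb by metis
    then obtain A h where h: "x = CPoint A h" "h \<in> ring_hom (ring_on A) field_ring"
      "\<forall>f\<in>A. h f = 0 \<longleftrightarrow> f \<notin> runits A"
      unfolding complex_points_def by (elim CollectE exE conjE)
    have "h (a * b) = h a * h b" if "a \<in> A" "b \<in> A" for a b
      using ring_hom_mult[OF h(2)] that by (simp add: ring_of_type_algebra_def)
    then show ?thesis
      using A h by (simp add: abs_point_def norm_mult)
  qed
qed

lemma abs_point_pabs_pos: "abs_point x \<Longrightarrow> a \<in> runits (local_ring x) \<Longrightarrow> pabs x a > 0"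
  unfolding abs_point_def by (metis (no_types, lifting) less_eq_real_def mem_Collect_eq runits_def)


subsection \<open>Logarithms of absolute values\<close>

definition log_sum :: "('k::field, 'f::field) point \<Rightarrow> ('f \<Rightarrow>\<^sub>0 real) \<Rightarrow> real" where
  "log_sum x z = (\<Sum>a\<in>keys z. lookup z a * ln (pabs x a))"

lemma log_sum_superset:
  "finite T \<Longrightarrow> keys z \<subseteq> T \<Longrightarrow> log_sum x z = (\<Sum>a\<in>T. lookup z a * ln (pabs x a))"
  unfolding log_sum_def by (rule sum.mono_neutral_left) (auto simp: Poly_Mapping.in_keys_iff)

lemma log_sum_diff: "log_sum x (z - w) = log_sum x z - log_sum x w"
proof -
  let ?T = "keys z \<union> keys w"
  have "keys (z - w) \<subseteq> ?T" by (auto simp: Poly_Mapping.in_keys_iff lookup_minus)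
  then show ?thesis
    by (simp add: log_sum_superset[of ?T] lookup_minus left_diff_distrib sum_subtractf)
qed

lemma log_sum_scale: "log_sum x (pscale r z) = r * log_sum x z"
  by (simp add: log_sum_superset[OF finite_keys keys_pscale_subset, of x r z] log_sum_def[of x z]
      sum_distrib_left mult.assoc)

text \<open>Two representatives by units differ by a relation whose keys are units, and the
  logarithm of \<open>pabs x\<close> is additive on units. Hence the definite description has a
  unique solution.\<close>

lemma log_abs_eq:
  assumes x: "abs_point x" and \<phi>: "\<phi> \<in> rat_R" and z: "z \<in> \<phi>" "keys z \<subseteq> runits (local_ring x)"
  shows "log_abs x \<phi> = log_sum x z"
  unfolding log_abs_def
proof (rule the_equality)
  show "\<exists>w\<in>\<phi>. keys w \<subseteq> runits (local_ring x) \<and>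
      log_sum x z = (\<Sum>a\<in>keys w. lookup w a * ln (pabs x a))"
    using z by (auto simp: log_sum_def)
next
  fix l assume "\<exists>z\<in>\<phi>. keys z \<subseteq> runits (local_ring x) \<and>
      l = (\<Sum>a\<in>keys z. lookup z a * ln (pabs x a))"
  then obtain w where w: "w \<in> \<phi>" "keys w \<subseteq> runits (local_ring x)" "l = log_sum x w"
    by (auto simp: log_sum_def)
  obtain z0 where "\<phi> = rclass rat_group z0" using \<phi> by (rule real_tensor_cases)
  with z w have "w - z \<in> sum_relations rat_group"
    using sum_relations_diff_trans[of w z0 rat_group z] sum_relations_minus_commute[of z0 z rat_group]
    by (simp add: rclass_def)
  moreover have "keys (w - z) \<subseteq> keys w \<union> keys z"
    by (auto simp: Poly_Mapping.in_keys_iff lookup_minus)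
  then have "keys (w - z) \<subseteq> runits (local_ring x)"
    using z(2) w(2) by blast
  moreover have "mult_subgroup (runits (local_ring x))"
    using x mult_subgroup_runits[of "{local_ring x}"] by (simp add: abs_point_def)
  moreover have "ln (pabs x (a * b)) = ln (pabs x a) + ln (pabs x b)"
    if "a \<in> runits (local_ring x)" "b \<in> runits (local_ring x)" for a b
    using that x abs_point_pabs_pos[OF x that(1)] abs_point_pabs_pos[OF x that(2)]
    by (simp add: abs_point_def runits_def ln_mult)
  ultimately have "log_sum x (w - z) = 0"
    unfolding log_sum_def by (rule sum_relations_additive)
  then show "l = log_sum x z" by (simp add: log_sum_diff w)
qed

lemma log_abs_scale:
  assumes x: "abs_point x" and \<phi>: "\<phi> \<in> rat_R" and z: "z \<in> \<phi>" "keys z \<subseteq> runits (local_ring x)"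
  shows "log_abs x (rt_scale rat_group r \<phi>) = r * log_abs x \<phi>"
proof -
  obtain z0 where z0: "z0 \<in> formal_sums rat_group" "\<phi> = rclass rat_group z0"
    using \<phi> by (rule real_tensor_cases)
  have "pscale r z \<in> rt_scale rat_group r \<phi>"
    using z(1) sum_relations_scale[of "z - z0" rat_group r]
    by (simp add: z0(2) rt_scale_rclass[OF z0(1)])
      (simp add: rclass_def formal_sums_scale fs.scale_right_diff_distrib)
  moreover have "keys (pscale r z) \<subseteq> runits (local_ring x)"
    using z(2) keys_pscale_subset by (rule order.trans[rotated])
  ultimately show ?thesis
    using log_abs_eq[OF x rt_scale_in[OF \<phi>]] log_abs_eq[OF x \<phi> z] by (simp add: log_sum_scale)
qed


subsection \<open>The topology of the analytification\<close>

text \<open>At a finite place this is the subbasic set of the element f tensor 1; at an embedding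
  the modulus pulls \<open>W\<close> back to an open set of complex numbers.\<close>

lemma openin_an_pabs:
  assumes Xs: "mult_rings Xs" and W: "open W"
  shows "openin (an_top \<iota> Xs v) {x \<in> an \<iota> Xs v. f \<in> local_ring x \<and> pabs x f \<in> W}"
proof (cases v)
  case (Fin p)
  have "{x \<in> an \<iota> Xs v. f \<in> local_ring x \<and> pabs x f \<in> W} =
      {NPoint A N | A N. NPoint A N \<in> berkovich_points \<iota> Xs p \<and>
        keys (frag_of (f, 1)) \<subseteq> A \<times> cauchy_seqs p \<and> N (frag_of (f, 1)) \<in> W}"
    unfolding Fin topspace_an_Fin using one_in_cauchy_seqs
    by (auto simp: berkovich_points_def)
  then show ?thesis
    unfolding Fin an_top.simps using W by (intro topology_generated_by_Basis) blast
next
  case (Emb \<sigma>)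
  have "{x \<in> an \<iota> Xs v. f \<in> local_ring x \<and> pabs x f \<in> W} =
      {CPoint A h | A h. CPoint A h \<in> complex_points \<iota> Xs \<sigma> \<and> f \<in> A \<and> h f \<in> cmod -` W}"
    unfolding Emb topspace_an_Emb[OF Xs]
    by (auto simp: complex_points_def)
  moreover have "open (cmod -` W)"
    using W by (intro open_vimage continuous_intros)
  ultimately show ?thesis
    unfolding Emb an_top.simps by (intro topology_generated_by_Basis) blast
qed

lemma openin_an_domain:
  "mult_rings Xs \<Longrightarrow> openin (an_top \<iota> Xs v) {x \<in> an \<iota> Xs v. f \<in> local_ring x}"
  using openin_an_pabs[of Xs UNIV] by simp

lemma openin_an_domain_finite:
  assumes "mult_rings Xs" "finite T"
  shows "openin (an_top \<iota> Xs v) {x \<in> an \<iota> Xs v. T \<subseteq> local_ring x}"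
proof -
  have "{x \<in> an \<iota> Xs v. T \<subseteq> local_ring x} =
      topspace (an_top \<iota> Xs v) \<inter> \<Inter> ((\<lambda>f. {x \<in> an \<iota> Xs v. f \<in> local_ring x}) ` T)" by blast
  also have "openin (an_top \<iota> Xs v) \<dots>"
    using assms by (intro openin_Int_Inter) (auto simp: openin_an_domain)
  finally show ?thesis .
qed

lemma openin_an_zariski:
  assumes Xs: "mult_rings Xs" and U: "openin (zariski Xs) U"
  shows "openin (an_top \<iota> Xs v) {x \<in> an \<iota> Xs v. local_ring x \<in> U}"
proof -
  have "continuous_map (an_top \<iota> Xs v) (zariski Xs) local_ring"
    unfolding zariski_def
  proof (rule continuous_on_generated_topo)
    fix S assume "S \<in> range (\<lambda>f. {A \<in> Xs. f \<in> A})"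
    then obtain f where "S = {A \<in> Xs. f \<in> A}" by auto
    then have "local_ring -` S \<inter> an \<iota> Xs v = {x \<in> an \<iota> Xs v. f \<in> local_ring x}"
      using local_ring_in[OF Xs] by auto
    then show "openin (an_top \<iota> Xs v) (local_ring -` S \<inter> an \<iota> Xs v)"
      using openin_an_domain[OF Xs] by simp
  qed (use topspace_zariski[OF Xs] local_ring_in[OF Xs] in \<open>auto simp: zariski_def\<close>)
  then show ?thesis using U by (rule openin_continuous_map_preimage)
qed

lemma continuous_map_pabs:
  assumes Xs: "mult_rings Xs" and S: "S \<subseteq> {x \<in> an \<iota> Xs v. f \<in> local_ring x}"
  shows "continuous_map (subtopology (an_top \<iota> Xs v) S) euclideanreal (\<lambda>x. pabs x f)"
  unfolding continuous_map_def
proof (intro conjI allI impI)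
  fix W :: "real set" assume "openin euclideanreal W"
  then have "openin (an_top \<iota> Xs v) {x \<in> an \<iota> Xs v. f \<in> local_ring x \<and> pabs x f \<in> W}"
    using openin_an_pabs[OF Xs] by simp
  moreover have "{x \<in> topspace (subtopology (an_top \<iota> Xs v) S). pabs x f \<in> W} =
      {x \<in> an \<iota> Xs v. f \<in> local_ring x \<and> pabs x f \<in> W} \<inter> S"
    using S by auto
  ultimately show "openin (subtopology (an_top \<iota> Xs v) S)
      {x \<in> topspace (subtopology (an_top \<iota> Xs v) S). pabs x f \<in> W}"
    by (auto simp: openin_subtopology)
qed auto

lemma continuous_map_real_iff_tendsto:
  "continuous_map T euclideanreal f \<longleftrightarrow> (\<forall>x\<in>topspace T. (f \<longlongrightarrow> f x) (atin T x))"
  by (simp add: continuous_map_atin)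

lemma continuous_map_localI:
  assumes "\<And>x. x \<in> topspace T \<Longrightarrow>
    \<exists>W. openin T W \<and> x \<in> W \<and> continuous_map (subtopology T W) Y f"
  shows "continuous_map T Y f"
  unfolding continuous_map_def
proof (intro conjI allI impI)
  show "f \<in> topspace T \<rightarrow> topspace Y"
  proof
    fix x assume x: "x \<in> topspace T"
    then obtain W where "x \<in> W" "continuous_map (subtopology T W) Y f" using assms by blast
    with x show "f x \<in> topspace Y" by (auto simp: continuous_map_def Pi_iff)
  qed
  fix U assume U: "openin Y U"
  show "openin T {x \<in> topspace T. f x \<in> U}"
  proof (subst openin_subopen, intro ballI)
    fix x assume x: "x \<in> {x \<in> topspace T. f x \<in> U}"
    then obtain W where W: "openin T W" "x \<in> W" "continuous_map (subtopology T W) Y f"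
      using assms by blast
    then have "openin (subtopology T W) {y \<in> topspace (subtopology T W). f y \<in> U}"
      using U by (simp add: continuous_map_def)
    then have "openin T {y \<in> topspace (subtopology T W). f y \<in> U}"
      using W(1) by (simp add: openin_open_subtopology)
    then show "\<exists>S. openin T S \<and> x \<in> S \<and> S \<subseteq> {x \<in> topspace T. f x \<in> U}"
      using x W by (intro exI[of _ "{y \<in> topspace (subtopology T W). f y \<in> U}"]) auto
  qed
qed

section \<open>Complex conjugation on places and points\<close>

lemma local_ring_F_inf [simp]: "local_ring (F_inf x) = local_ring x"
  by (cases x) auto

lemma F_inf_F_inf [simp]: "F_inf (F_inf x) = x"
  by (cases x) (auto simp: fun_eq_iff)

lemma conj_conj_place [simp]: "conj_place (conj_place v) = v"
  by (cases v) (auto simp: fun_eq_iff)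

lemma cnj_embedding: "\<sigma> \<in> embeddings \<Longrightarrow> cnj \<circ> \<sigma> \<in> embeddings"
  by (auto simp: embeddings_def ring_hom_def ring_of_type_algebra_def)

lemma conj_place_in: "v \<in> places \<Longrightarrow> conj_place v \<in> places"
  by (cases v) (auto simp: places_def dest: cnj_embedding)

lemma complex_points_F_inf:
  assumes "x \<in> complex_points \<iota> Xs \<sigma>"
  shows "F_inf x \<in> complex_points \<iota> Xs (cnj \<circ> \<sigma>)"
proof -
  obtain A h where h: "x = CPoint A h" "A \<in> Xs" "\<forall>f. f \<notin> A \<longrightarrow> h f = 0"
    "h \<in> ring_hom (ring_on A) field_ring" "\<forall>k. h (\<iota> k) = \<sigma> k" "\<forall>f\<in>A. h f = 0 \<longleftrightarrow> f \<notin> runits A"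
    using assms unfolding complex_points_def by blast
  have "cnj \<circ> h \<in> ring_hom (ring_on A) field_ring"
    using h(4) by (auto simp: ring_hom_def ring_of_type_algebra_def)
  then show ?thesis using h unfolding complex_points_def by auto
qed

lemma F_inf_an:
  assumes "mult_rings Xs" "x \<in> an \<iota> Xs v"
  shows "F_inf x \<in> an \<iota> Xs (conj_place v)"
proof (cases v)
  case (Fin p)
  with assms have "x \<in> berkovich_points \<iota> Xs p" using topspace_an_Fin by metis
  then have "F_inf x = x" by (auto simp: berkovich_points_def)
  then show ?thesis using assms Fin by simp
next
  case (Emb \<sigma>)
  with assms have "x \<in> complex_points \<iota> Xs \<sigma>" using topspace_an_Emb by metis
  then show ?thesis
    using complex_points_F_inf topspace_an_Emb[OF assms(1)] unfolding Emb conj_place.simps by blast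
qed

text \<open>Conjugation pulls the subbasic set given by \<open>f\<close> and \<open>W\<close> back
  to the one given by \<open>f\<close> and the preimage of \<open>W\<close> under
  \<open>cnj\<close>.\<close>

lemma continuous_map_F_inf:
  fixes \<iota> :: "'k::field_char_0 \<Rightarrow> 'f::field"
  assumes Xs: "mult_rings Xs"
  shows "continuous_map (an_top \<iota> Xs (Emb (cnj \<circ> \<sigma>))) (an_top \<iota> Xs (Emb \<sigma>)) F_inf"
  unfolding an_top.simps(2)[of \<iota> Xs \<sigma>]
proof (rule continuous_on_generated_topo)
  have cc: "cnj \<circ> (cnj \<circ> g) = g" for g :: "'c \<Rightarrow> complex" by (auto simp: fun_eq_iff)
  let ?T = "an_top \<iota> Xs (Emb (cnj \<circ> \<sigma>))"
  let ?S = "{{(CPoint A h :: ('k, 'f) point) | A h. CPoint A h \<in> complex_points \<iota> Xs \<sigma> \<and> f \<in> A \<and> h f \<in> W} | f W. open W}"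
  have an: "topspace ?T = complex_points \<iota> Xs (cnj \<circ> \<sigma>)" by (rule topspace_an_Emb[OF Xs])
  show "F_inf ` topspace ?T \<subseteq> \<Union> ?S"
    using F_inf_an[OF Xs, of _ \<iota> "Emb (cnj \<circ> \<sigma>)"]
    unfolding conj_place.simps cc an_top.simps(2)[of \<iota> Xs \<sigma>] topology_generated_by_topspace by blast
  fix U assume "U \<in> ?S"
  then obtain f W where W: "open W"
    and U: "U =
      {(CPoint A h :: ('k, 'f) point) | A h. CPoint A h \<in> complex_points \<iota> Xs \<sigma> \<and> f \<in> A \<and> h f \<in> W}" by blast
  have "F_inf -` U \<inter> topspace ?T =
    {(CPoint A h :: ('k, 'f) point) | A h. CPoint A h \<in> complex_points \<iota> Xs (cnj \<circ> \<sigma>) \<and> f \<in> A \<and> h f \<in> cnj -` W}"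
  proof (intro equalityI subsetI)
    fix x assume x: "x \<in> F_inf -` U \<inter> topspace ?T"
    then obtain A h where "x = CPoint A h" by (auto simp: an complex_points_def)
    with x show "x \<in> {(CPoint A h :: ('k, 'f) point) | A h. CPoint A h \<in> complex_points \<iota> Xs (cnj \<circ> \<sigma>) \<and> f \<in> A \<and> h f \<in> cnj -` W}"
      by (auto simp: an U)
  next
    fix x assume "x \<in> {(CPoint A h :: ('k, 'f) point) | A h. CPoint A h \<in> complex_points \<iota> Xs (cnj \<circ> \<sigma>) \<and> f \<in> A \<and> h f \<in> cnj -` W}"
    then obtain A h where x: "x = CPoint A h" "CPoint A h \<in> complex_points \<iota> Xs (cnj \<circ> \<sigma>)" "f \<in> A" "h f \<in> cnj -` W"
      by blast
    then show "x \<in> F_inf -` U \<inter> topspace ?T"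
      unfolding an using complex_points_F_inf[OF x(2)] by (simp add: U cc)
  qed
  moreover have "open (cnj -` W)" using W by (intro open_vimage continuous_intros)
  ultimately show "openin ?T (F_inf -` U \<inter> topspace ?T)"
    unfolding an_top.simps by (simp only:, intro topology_generated_by_Basis) blast
qed


section \<open>Effective divisors and their Green functions\<close>

definition exp_green ::
  "('k::field_char_0 \<Rightarrow> 'f::field) \<Rightarrow> 'f set set \<Rightarrow> 'k place \<Rightarrow> 'f rdiv \<Rightarrow>
   (('k, 'f) point \<Rightarrow> real) \<Rightarrow> ('k, 'f) point \<Rightarrow> real" where
  "exp_green \<iota> Xs v D g x = (if x \<in> off_supp \<iota> Xs v D then exp (- g x) else 0)"

text \<open>Locally \<open>D\<close> has an equation \<open>\<phi> = \<Prod> a\<^bsup>c(a)\<^esup>\<close> with regular \<open>a\<close> and \<open>c(a) > 0\<close>, and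
  \<open>exp (- g)\<close> is the product of a continuous function with \<open>\<Prod> |a|\<^bsup>2 c(a)\<^esup>\<close>, which vanishes
  exactly on the support of \<open>D\<close>.\<close>

lemma continuous_map_exp_green:
  assumes Xs: "mult_rings Xs" and eff: "effective_rdiv Xs D" and g: "green \<iota> Xs v D g"
  shows "continuous_map (an_top \<iota> Xs v) euclideanreal (exp_green \<iota> Xs v D g)"
proof (rule continuous_map_localI)
  let ?T = "an_top \<iota> Xs v"
  fix x assume x: "x \<in> topspace ?T"
  obtain U z where U: "openin (zariski Xs) U" "local_ring x \<in> U"
    and le: "local_equation D U (rclass rat_group z)" and z: "finite (keys z)" "keys z \<subseteq> local_ring x"
    and pos: "\<And>a. a \<in> keys z \<Longrightarrow> lookup z a > 0"
    and supp: "\<And>B. B \<in> U \<Longrightarrow> keys z \<subseteq> B \<Longrightarrow> B \<notin> Supp Xs D \<longleftrightarrow> keys z \<subseteq> runits B"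
    using effective_local_equation[OF Xs eff local_ring_in[OF Xs x]] by metis
  let ?\<phi> = "rclass rat_group z"
  obtain W u where W: "openin ?T W" "x \<in> W" "\<forall>y\<in>W. local_ring y \<in> U"
    and u: "continuous_map (subtopology ?T W) euclideanreal u"
      "\<forall>y\<in>W \<inter> off_supp \<iota> Xs v D. u y = g y + 2 * log_abs y ?\<phi>"
    using g U le x unfolding green_def by meson
  \<comment> \<open>Shrinking to the points where all keys of \<open>z\<close> are regular makes
    each \<open>pabs y a\<close> meaningful and continuous.\<close>
  define W1 where "W1 = W \<inter> {y \<in> an \<iota> Xs v. keys z \<subseteq> local_ring y}"
  have W1: "openin ?T W1" unfolding W1_def
    using W(1) openin_an_domain_finite[OF Xs z(1)] by (rule openin_Int)
  have xW1: "x \<in> W1" using W x z by (simp add: W1_def)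
  have W1an: "W1 \<subseteq> an \<iota> Xs v" by (auto simp: W1_def)
  \<comment> \<open>From \<open>u = g + 2 log |\<phi>|\<close> follows
    \<open>exp (- g) = exp (- u) * |\<phi>|^2\<close>, and \<open>|\<phi>|^2\<close> is this
    product. The convention \<open>0 powr r = 0\<close> gives the right value on the
    support.\<close>
  define h where "h y = exp (- u y) * (\<Prod>a\<in>keys z. pabs y a powr (2 * lookup z a))" for y
  have eq: "exp_green \<iota> Xs v D g y = h y" if y: "y \<in> W1" for y
  proof -
    let ?B = "local_ring y"
    have yan: "y \<in> an \<iota> Xs v" and B: "?B \<in> U" "keys z \<subseteq> ?B" and yW: "y \<in> W"
      using y W(3) by (auto simp: W1_def)
    have ap: "abs_point y" using abs_point_an[OF Xs yan] .
    show ?thesis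
    proof (cases "keys z \<subseteq> runits ?B")
      case True
      then have off: "y \<in> off_supp \<iota> Xs v D" using supp[OF B] yan by (simp add: off_supp_def)
      have \<phi>: "?\<phi> \<in> rat_R" using le by (simp add: local_equation_def)
      have "z \<in> ?\<phi>" using True
        by (intro rclass_self) (auto simp: formal_sums_def rat_group_def runits_def)
      then have "log_abs y ?\<phi> = log_sum y z" using True by (intro log_abs_eq[OF ap \<phi>])
      moreover have "(\<Prod>a\<in>keys z. pabs y a powr (2 * lookup z a)) = exp (2 * log_sum y z)"
      proof -
        have "pabs y a powr (2 * lookup z a) = exp (2 * (lookup z a * ln (pabs y a)))"
          if "a \<in> keys z" for a
          using abs_point_pabs_pos[OF ap] that True by (fastforce simp: powr_def)
        then show ?thesis by (simp add: log_sum_def sum_distrib_left exp_sum)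
      qed
      ultimately show ?thesis
        using u(2) off yW by (simp add: exp_green_def h_def flip: exp_add)
    next
      case False
      then obtain a where a: "a \<in> keys z" "a \<notin> runits ?B" by blast
      then have "pabs y a = 0" using ap B by (auto simp: abs_point_def)
      with a z(1) have "(\<Prod>a\<in>keys z. pabs y a powr (2 * lookup z a)) = 0"
        by (intro prod_zero) auto
      moreover have "y \<notin> off_supp \<iota> Xs v D" using False supp[OF B] by (simp add: off_supp_def)
      ultimately show ?thesis by (simp add: exp_green_def h_def)
    qed
  qed
  let ?T1 = "subtopology ?T W1"
  have cont_u: "continuous_map ?T1 euclideanreal u"
    using u(1) by (rule continuous_map_from_subtopology_mono) (simp add: W1_def)
  have cont_pabs: "continuous_map ?T1 euclideanreal (\<lambda>y. pabs y a)" if "a \<in> keys z" for a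
    using that by (intro continuous_map_pabs[OF Xs]) (auto simp: W1_def)
  have "continuous_map ?T1 euclideanreal h"
    unfolding continuous_map_real_iff_tendsto
  proof
    fix y assume y: "y \<in> topspace ?T1"
    have "((\<lambda>w. pabs w a powr (2 * lookup z a)) \<longlongrightarrow> pabs y a powr (2 * lookup z a)) (atin ?T1 y)"
      if a: "a \<in> keys z" for a
    \<comment> \<open>The limit of the base may be 0; convergence then relies on nonnegativity
      nearby and on a strictly positive exponent.\<close>
    proof (rule tendsto_powr2)
      show "((\<lambda>w. pabs w a) \<longlongrightarrow> pabs y a) (atin ?T1 y)"
        using cont_pabs[OF a] y unfolding continuous_map_real_iff_tendsto by blast
      have "0 \<le> pabs w a" if "w \<in> topspace ?T1" for w
        using that a abs_point_an[OF Xs, of w \<iota> v] by (auto simp: W1_def abs_point_def)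
      then show "\<forall>\<^sub>F w in atin ?T1 y. 0 \<le> pabs w a"
        unfolding eventually_atin using openin_topspace y by blast
    qed (use pos[OF a] in auto)
    moreover have "(u \<longlongrightarrow> u y) (atin ?T1 y)"
      using cont_u y unfolding continuous_map_real_iff_tendsto by blast
    ultimately show "(h \<longlongrightarrow> h y) (atin ?T1 y)"
      unfolding h_def by (intro tendsto_mult tendsto_exp tendsto_minus tendsto_prod)
  qed
  then have "continuous_map ?T1 euclideanreal (exp_green \<iota> Xs v D g)"
    by (rule continuous_map_eq) (use eq in auto)
  with W1 xW1 show "\<exists>W. openin ?T W \<and> x \<in> W \<and>
      continuous_map (subtopology ?T W) euclideanreal (exp_green \<iota> Xs v D g)" by blast
qed


section \<open>Adelic arithmetic divisors\<close>

declare an_top.simps [simp del]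

lemma off_supp_zero [simp]: "off_supp \<iota> Xs v (rclass (cartier Xs) 0) = an \<iota> Xs v"
  by (simp add: off_supp_def)

lemma off_supp_scale:
  "D \<in> div_R Xs \<Longrightarrow> r \<noteq> 0 \<Longrightarrow> off_supp \<iota> Xs v (rt_scale (cartier Xs) r D) = off_supp \<iota> Xs v D"
  by (simp add: off_supp_def Supp_scale)

lemma off_supp_add:
  assumes "mult_rings Xs" "D \<in> div_R Xs" "E \<in> div_R Xs"
  shows "off_supp \<iota> Xs v D \<inter> off_supp \<iota> Xs v (rt_add (cartier Xs) D E) =
    off_supp \<iota> Xs v D \<inter> off_supp \<iota> Xs v E"
  using Supp_add_iff[OF local_ring_in[OF assms(1)] assms(2,3)] by (auto simp: off_supp_def)

text \<open>The filter \<open>atin_within T x S\<close> sees only points of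
  \<open>S\<close>.\<close>

lemma cont_ext_cong:
  assumes "\<And>y. y \<in> S \<Longrightarrow> f y = g y"
  shows "cont_ext T S f x = cont_ext T S g x"
proof -
  have "\<forall>\<^sub>F y in atin_within T x S. ereal (f y) = ereal (g y)"
    unfolding eventually_atin_within using assms openin_topspace by blast
  from Liminf_eq[OF this] show ?thesis by (simp add: cont_ext_def assms)
qed

lemma log_abs_scale_off_supp:
  assumes Xs: "mult_rings Xs" and \<phi>: "\<phi> \<in> rat_R" and y: "y \<in> off_supp \<iota> Xs v (principal_rdiv Xs \<phi>)"
  shows "log_abs y (rt_scale rat_group r \<phi>) = r * log_abs y \<phi>"
proof -
  have an: "y \<in> an \<iota> Xs v" and off: "local_ring y \<notin> Supp Xs (principal_rdiv Xs \<phi>)"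
    using y by (auto simp: off_supp_def)
  obtain z where "z \<in> \<phi>" "keys z \<subseteq> runits (local_ring y)"
    using unit_representative_off_Supp[OF Xs local_ring_in[OF Xs an] \<phi> off] .
  then show ?thesis by (rule log_abs_scale[OF abs_point_an[OF Xs an] \<phi>])
qed

lemma snd_ad_principal:
  "v \<in> places \<Longrightarrow> y \<in> off_supp \<iota> Xs v (principal_rdiv Xs \<phi>) \<Longrightarrow>
   snd (ad_principal \<iota> Xs \<phi>) v y = - 2 * log_abs y \<phi>"
  by (simp add: ad_principal_def)

lemma snd_ad_add:
  assumes "v \<in> places" "y \<in> off_supp \<iota> Xs v (fst (ad_add \<iota> Xs P Q))"
    "y \<in> off_supp \<iota> Xs v (fst P)" "y \<in> off_supp \<iota> Xs v (fst Q)"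
  shows "snd (ad_add \<iota> Xs P Q) v y = snd P v y + snd Q v y"
  using assms by (simp add: ad_add_def Let_def cont_ext_def)

text \<open>Both sides are extensions by continuity of the same function on the same set: off any two of
  the supports of \<open>D\<close>, \<open>(s)\<close> and \<open>D + (s)\<close> one is off the third.\<close>

lemma ad_add_scale_principal:
  assumes Xs: "mult_rings Xs" and D: "fst D \<in> div_R Xs" and s: "s \<in> rat_R" and e: "e > 0"
  shows "ad_add \<iota> Xs D (ad_scale Xs e (ad_add \<iota> Xs D (ad_principal \<iota> Xs s))) =
    ad_add \<iota> Xs (ad_scale Xs (1 + e) D) (ad_principal \<iota> Xs (rt_scale rat_group e s))"
proof -
  let ?G = "cartier Xs" and ?P = "principal_rdiv Xs s"
  let ?E = "ad_add \<iota> Xs D (ad_principal \<iota> Xs s)"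
  let ?L1 = "ad_scale Xs e ?E" and ?R1 = "ad_scale Xs (1 + e) D"
    and ?R2 = "ad_principal \<iota> Xs (rt_scale rat_group e s)"
  have P: "?P \<in> div_R Xs" by (rule principal_rdiv_in[OF Xs s])
  have fstE: "fst ?E = rt_add ?G (fst D) ?P"
    by (simp add: ad_add_def ad_principal_def Let_def)
  have fst1: "fst ?L1 = rt_scale ?G e (rt_add ?G (fst D) ?P)"
    by (simp add: ad_scale_def fstE)
  have fst2: "fst ?R1 = rt_scale ?G (1 + e) (fst D)" "fst ?R2 = rt_scale ?G e ?P"
    by (simp_all add: ad_scale_def ad_principal_def principal_rdiv_scale[OF Xs s])
  have div_eq: "rt_add ?G (fst D) (fst ?L1) = rt_add ?G (fst ?R1) (fst ?R2)"
    unfolding fst1 fst2 by (rule rt_combine[OF D P])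
  have S1: "off_supp \<iota> Xs v (fst D) \<inter> off_supp \<iota> Xs v (fst ?L1) =
      off_supp \<iota> Xs v (fst D) \<inter> off_supp \<iota> Xs v ?P" for v
    unfolding fst1 using e
    by (simp add: off_supp_scale[OF rt_add_in[OF D P]] off_supp_add[OF Xs D P])
  have S2: "off_supp \<iota> Xs v (fst ?R1) \<inter> off_supp \<iota> Xs v (fst ?R2) =
      off_supp \<iota> Xs v (fst D) \<inter> off_supp \<iota> Xs v ?P" for v
    unfolding fst2 using e by (simp add: off_supp_scale[OF D] off_supp_scale[OF P])
  \<comment> \<open>Both sums equal (1 + e) g_D - 2 e log |s|. The point is off both supports, so
    the inner \<open>ad_add\<close> is a plain sum there.\<close>
  have eq: "snd D v y + snd ?L1 v y = snd ?R1 v y + snd ?R2 v y"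
    if v: "v \<in> places" and y: "y \<in> off_supp \<iota> Xs v (fst D) \<inter> off_supp \<iota> Xs v ?P" for v y
  proof -
    have yE: "y \<in> off_supp \<iota> Xs v (fst ?E)"
      using y off_supp_add[OF Xs D P, of \<iota> v] unfolding fstE by blast
    have "snd ?E v y = snd D v y - 2 * log_abs y s"
      using snd_ad_add[OF v yE] y by (simp add: ad_principal_def v)
    moreover have "y \<in> off_supp \<iota> Xs v (principal_rdiv Xs (rt_scale rat_group e s))"
      using y e by (simp add: principal_rdiv_scale[OF Xs s] off_supp_scale[OF P])
    then have "snd ?R2 v y = - 2 * (e * log_abs y s)"
      using log_abs_scale_off_supp[OF Xs s, of y \<iota> v e] y by (simp add: snd_ad_principal v)
    ultimately show ?thesis by (simp add: ad_scale_def) (simp add: algebra_simps)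
  qed
  have "cont_ext (an_top \<iota> Xs v) (off_supp \<iota> Xs v (fst D) \<inter> off_supp \<iota> Xs v (fst ?L1))
      (\<lambda>y. snd D v y + snd ?L1 v y) x =
    cont_ext (an_top \<iota> Xs v) (off_supp \<iota> Xs v (fst ?R1) \<inter> off_supp \<iota> Xs v (fst ?R2))
      (\<lambda>y. snd ?R1 v y + snd ?R2 v y) x" if "v \<in> places" for v x
    unfolding S1 S2 by (rule cont_ext_cong) (rule eq[OF that])
  then show ?thesis
    unfolding ad_add_def[of \<iota> Xs D ?L1] ad_add_def[of \<iota> Xs ?R1 ?R2] Let_def div_eq
    by (auto simp: fun_eq_iff)
qed


subsection \<open>The divisors of continuous functions\<close>

lemma fst_O_bar [simp]: "fst (O_bar \<iota> Xs v f) = rclass (cartier Xs) 0"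
  by (simp add: O_bar_def)

lemma O_bar_outside: "x \<notin> an \<iota> Xs w \<Longrightarrow> snd (O_bar \<iota> Xs v f) w x = 0"
  by (simp add: O_bar_def)

lemma O_bar_Fin:
  "x \<in> an \<iota> Xs w \<Longrightarrow> snd (O_bar \<iota> Xs (Fin p) f) w x = (if w = Fin p then f x else 0)"
  by (simp add: O_bar_def)

text \<open>At a real embedding both conditions hold, and the value is the mean of \<open>f\<close>
  at \<open>x\<close> and at its conjugate.\<close>

lemma O_bar_Emb:
  "x \<in> an \<iota> Xs w \<Longrightarrow> snd (O_bar \<iota> Xs (Emb \<sigma>) f) w x =
     (if w = Emb \<sigma> then f x / 2 else 0) + (if w = conj_place (Emb \<sigma>) then f (F_inf x) / 2 else 0)"
  by (simp add: O_bar_def)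

lemma O_bar_nonneg:
  assumes Xs: "mult_rings Xs" and f: "f \<in> nonneg_cont \<iota> Xs v" and x: "x \<in> an \<iota> Xs w"
  shows "snd (O_bar \<iota> Xs v f) w x \<ge> 0"
proof (cases v)
  case (Fin p)
  then show ?thesis using f x by (auto simp: O_bar_Fin nonneg_cont_def)
next
  case (Emb \<sigma>)
  have "f x \<ge> 0" if "w = v" using f x that by (simp add: nonneg_cont_def)
  moreover have "f (F_inf x) \<ge> 0" if "w = conj_place v"
    using F_inf_an[OF Xs x] f that by (simp add: nonneg_cont_def)
  ultimately show ?thesis using Emb by (simp add: O_bar_Emb[OF x])
qed

lemma continuous_map_O_bar:
  assumes Xs: "mult_rings Xs" and f: "f \<in> nonneg_cont \<iota> Xs v"
  shows "continuous_map (an_top \<iota> Xs w) euclideanreal (snd (O_bar \<iota> Xs v f) w)"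
proof (cases v)
  case (Fin p)
  have "continuous_map (an_top \<iota> Xs w) euclideanreal (\<lambda>x. if w = Fin p then f x else 0)"
    using f Fin by (cases "w = Fin p") (simp_all add: nonneg_cont_def)
  then show ?thesis
    unfolding Fin by (rule continuous_map_eq) (simp add: O_bar_Fin)
next
  case (Emb \<sigma>)
  have "continuous_map (an_top \<iota> Xs w) euclideanreal (\<lambda>x. if w = Emb \<sigma> then f x / 2 else 0)"
    using f Emb by (cases "w = Emb \<sigma>") (auto simp: nonneg_cont_def intro!: continuous_map_real_divide)
  moreover have "continuous_map (an_top \<iota> Xs w) euclideanreal
      (\<lambda>x. if w = conj_place (Emb \<sigma>) then f (F_inf x) / 2 else 0)"
  proof (cases "w = conj_place (Emb \<sigma>)")
    case True
    have "continuous_map (an_top \<iota> Xs w) euclideanreal (f \<circ> F_inf)"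
      using f Emb continuous_map_F_inf[OF Xs, of \<iota> \<sigma>] unfolding True nonneg_cont_def
      by (auto intro: continuous_map_compose)
    then have "continuous_map (an_top \<iota> Xs w) euclideanreal (\<lambda>x. f (F_inf x))"
      by (simp add: o_def)
    then show ?thesis using True by (auto intro!: continuous_map_real_divide)
  qed simp
  ultimately have "continuous_map (an_top \<iota> Xs w) euclideanreal
      (\<lambda>x. (if w = Emb \<sigma> then f x / 2 else 0) + (if w = conj_place (Emb \<sigma>) then f (F_inf x) / 2 else 0))"
    by (rule continuous_map_add)
  then show ?thesis
    unfolding Emb by (rule continuous_map_eq) (simp only: O_bar_Emb)
qed

text \<open>A local equation of the zero divisor has a representative by units at \<open>x\<close>.
  These stay units nearby, so \<open>log |\<phi>|\<close> is continuous there and adding it to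
  \<open>g\<close> preserves continuity.\<close>

lemma green_zero:
  assumes Xs: "mult_rings Xs" and cont: "continuous_map (an_top \<iota> Xs w) euclideanreal g"
    and out: "\<And>x. x \<notin> an \<iota> Xs w \<Longrightarrow> g x = 0"
  shows "green \<iota> Xs w (rclass (cartier Xs) 0) g"
  unfolding green_def off_supp_zero
proof (intro conjI allI impI ballI)
  let ?T = "an_top \<iota> Xs w"
  fix U \<phi> x
  assume U: "openin (zariski Xs) U \<and> local_equation (rclass (cartier Xs) 0) U \<phi>"
    and x: "x \<in> an \<iota> Xs w" "local_ring x \<in> U"
  have \<phi>: "\<phi> \<in> rat_R" using U by (simp add: local_equation_def)
  obtain z where z: "z \<in> \<phi>" "keys z \<subseteq> runits (local_ring x)"
    using unit_representative_local[OF Xs _ _ x(2)] openin_zariski_subset[OF Xs] U by metis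
  \<comment> \<open>Regularity of the inverses as well forces the keys to remain units on the
    neighbourhood.\<close>
  define R where "R = keys z \<union> inverse ` keys z"
  define W where "W = {y \<in> an \<iota> Xs w. local_ring y \<in> U} \<inter> {y \<in> an \<iota> Xs w. R \<subseteq> local_ring y}"
  have W: "openin ?T W"
    unfolding W_def R_def using U
    by (intro openin_Int openin_an_zariski[OF Xs] openin_an_domain_finite[OF Xs]) auto
  have xW: "x \<in> W" using x z(2) by (auto simp: W_def R_def runits_def)
  have units: "keys z \<subseteq> runits (local_ring y)" if "y \<in> W" for y
    using that z(2) by (auto simp: W_def R_def runits_def)
  have ap: "abs_point y" if "y \<in> W" for y
    using that abs_point_an[OF Xs, of y \<iota> w] by (simp add: W_def)
  let ?T1 = "subtopology ?T W"
  have cont_g: "continuous_map ?T1 euclideanreal g"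
    using cont by (rule continuous_map_from_subtopology)
  have cont_pabs: "continuous_map ?T1 euclideanreal (\<lambda>y. pabs y a)" if "a \<in> keys z" for a
    using that by (intro continuous_map_pabs[OF Xs]) (auto simp: W_def R_def)
  have "continuous_map ?T1 euclideanreal (\<lambda>y. g y + 2 * log_sum y z)"
    unfolding continuous_map_real_iff_tendsto
  proof
    fix y assume y: "y \<in> topspace ?T1"
    then have yW: "y \<in> W" by simp
    have "((\<lambda>w. ln (pabs w a)) \<longlongrightarrow> ln (pabs y a)) (atin ?T1 y)" if a: "a \<in> keys z" for a
    proof (rule tendsto_ln)
      show "((\<lambda>w. pabs w a) \<longlongrightarrow> pabs y a) (atin ?T1 y)"
        using cont_pabs[OF a] y unfolding continuous_map_real_iff_tendsto by blast
      show "pabs y a \<noteq> 0"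
        using abs_point_pabs_pos[OF ap[OF yW]] units[OF yW] a by fastforce
    qed
    moreover have "(g \<longlongrightarrow> g y) (atin ?T1 y)"
      using cont_g y unfolding continuous_map_real_iff_tendsto by blast
    ultimately show "((\<lambda>y. g y + 2 * log_sum y z) \<longlongrightarrow> g y + 2 * log_sum y z) (atin ?T1 y)"
      unfolding log_sum_def by (intro tendsto_add tendsto_mult tendsto_const tendsto_sum)
  qed
  moreover have "\<forall>y\<in>W \<inter> an \<iota> Xs w. g y + 2 * log_sum y z = g y + 2 * log_abs y \<phi>"
    using log_abs_eq[OF ap \<phi> z(1) units] by simp
  moreover have "\<forall>y\<in>W. local_ring y \<in> U" by (simp add: W_def)
  ultimately show "\<exists>W u. openin ?T W \<and> x \<in> W \<and> (\<forall>y\<in>W. local_ring y \<in> U) \<and>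
      continuous_map (subtopology ?T W) euclideanreal u \<and>
      (\<forall>y\<in>W \<inter> an \<iota> Xs w. u y = g y + 2 * log_abs y \<phi>)"
    using W xW by blast
qed (rule out)

text \<open>Units of the reduction \<open>B\<close> have absolute value 1 at \<open>x\<close>, so a
  local equation made of such units has logarithm 0.\<close>

lemma model_green_zero:
  assumes Xs: "mult_rings Xs" and Y: "mult_rings Y"
  shows "model_green \<iota> Xs (rclass (cartier Xs) 0) Y (rclass (cartier Y) 0) p (\<lambda>x. 0)"
  unfolding model_green_def off_supp_zero
proof (intro ballI allI impI)
  fix x B V \<phi>
  assume x: "x \<in> an \<iota> Xs (Fin p)"
    and "reduction Y x B \<and> openin (zariski Y) V \<and> B \<in> V \<and> local_equation (rclass (cartier Y) 0) V \<phi>"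
  then have red: "reduction Y x B" and V: "openin (zariski Y) V" "B \<in> V"
    and le: "local_equation (rclass (cartier Y) 0) V \<phi>" by auto
  obtain z where z: "z \<in> \<phi>" "keys z \<subseteq> runits B"
    using unit_representative_local[OF Y openin_zariski_subset[OF Y V(1)] le V(2)] .
  have "runits B \<subseteq> runits (local_ring x)"
    using red by (auto simp: reduction_def runits_def)
  then have "log_abs x \<phi> = log_sum x z"
    using z le by (intro log_abs_eq[OF abs_point_an[OF Xs x]]) (auto simp: local_equation_def)
  moreover have "pabs x a = 1" if "a \<in> keys z" for a
  proof -
    have "a \<in> runits B" "a \<in> B" using that z(2) by (auto simp: runits_def)
    with red show ?thesis by (force simp: reduction_def)
  qed
  ultimately show "0 = - 2 * log_abs x \<phi>" by (simp add: log_sum_def)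
qed

lemma O_bar_conj:
  fixes \<tau> :: "'k::field_char_0 \<Rightarrow> complex"
  assumes Xs: "mult_rings Xs" and x: "x \<in> an \<iota> Xs (Emb \<tau>)"
  shows "snd (O_bar \<iota> Xs v f) (Emb (cnj \<circ> \<tau>)) (F_inf x) = snd (O_bar \<iota> Xs v f) (Emb \<tau>) x"
proof -
  have Fx: "F_inf x \<in> an \<iota> Xs (Emb (cnj \<circ> \<tau>))" using F_inf_an[OF Xs x] by simp
  have cc: "cnj \<circ> (cnj \<circ> \<sigma>) = \<sigma>" for \<sigma> :: "'k \<Rightarrow> complex"
    by (simp add: fun_eq_iff)
  have eq: "cnj \<circ> \<tau> = \<sigma> \<longleftrightarrow> \<tau> = cnj \<circ> \<sigma>" for \<sigma>
    using cc by metis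
  have eq': "cnj \<circ> \<tau> = cnj \<circ> \<sigma> \<longleftrightarrow> \<tau> = \<sigma>" for \<sigma>
    using cc by metis
  show ?thesis
  proof (cases v)
    case (Fin p)
    then show ?thesis using x Fx by (simp add: O_bar_Fin)
  next
    case (Emb \<sigma>)
    then show ?thesis unfolding Emb O_bar_Emb[OF x] O_bar_Emb[OF Fx] by (simp add: eq eq' cc)
  qed
qed

text \<open>\<open>E\<close> supplies a model of \<open>Xs\<close>, on which the zero divisor is
  taken. At finite places other than \<open>v\<close> the function is 0 and agrees with the model
  Green function, so the exceptional primes are those outside \<open>U\<close> and possibly
  \<open>v\<close>.\<close>

lemma O_bar_adelic:
  assumes Xs: "mult_rings Xs" and E: "E \<in> adelic_div \<iota> Xs" and v: "v \<in> places"
    and f: "f \<in> nonneg_cont \<iota> Xs v"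
  shows "O_bar \<iota> Xs v f \<in> adelic_div \<iota> Xs"
proof -
  let ?O = "O_bar \<iota> Xs v f"
  obtain U Y E' where model: "is_model \<iota> Xs (fst E) U Y E'"
    using E unfolding adelic_div_def by auto
  have Y: "mult_rings Y" and XsY: "Xs \<subseteq> Y"
    using model projective_integral_mult_rings unfolding is_model_def by blast+
  have model0: "is_model \<iota> Xs (rclass (cartier Xs) 0) U Y (rclass (cartier Y) 0)"
    using model restrict_rdiv_zero[OF XsY] by (simp add: is_model_def rclass_in)
  have "{p \<in> MK. \<not> (p \<in> U \<and> model_green \<iota> Xs (rclass (cartier Xs) 0) Y (rclass (cartier Y) 0) p (snd ?O (Fin p)))}
      \<subseteq> (MK - U) \<union> {p. v = Fin p}"
  proof
    fix p assume p: "p \<in> {p \<in> MK. \<not> (p \<in> U \<and>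
        model_green \<iota> Xs (rclass (cartier Xs) 0) Y (rclass (cartier Y) 0) p (snd ?O (Fin p)))}"
    have "snd ?O (Fin p) = (\<lambda>x. 0)" if "v \<noteq> Fin p"
      using that by (cases v) (auto simp: O_bar_def fun_eq_iff)
    with p model_green_zero[OF Xs Y, of \<iota> p] show "p \<in> (MK - U) \<union> {p. v = Fin p}" by force
  qed
  moreover have "finite (MK - U)" using model by (simp add: is_model_def)
  moreover have "finite {p. v = Fin p}" by (cases v) auto
  ultimately have fin: "finite {p \<in> MK. \<not> (p \<in> U \<and>
      model_green \<iota> Xs (rclass (cartier Xs) 0) Y (rclass (cartier Y) 0) p (snd ?O (Fin p)))}"
    by (meson finite_UnI finite_subset)
  have green: "green \<iota> Xs w (rclass (cartier Xs) 0) (snd ?O w)" for w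
    by (rule green_zero[OF Xs continuous_map_O_bar[OF Xs f] O_bar_outside])
  have outside: "snd ?O w = (\<lambda>x. 0)" if "w \<notin> places" for w
  proof -
    have "w \<noteq> v" "w \<noteq> conj_place v" using that v conj_place_in by auto
    then show ?thesis by (cases v) (auto simp: O_bar_def fun_eq_iff)
  qed
  have conj: "\<forall>\<tau>\<in>embeddings. \<forall>x\<in>an \<iota> Xs (Emb \<tau>).
      snd ?O (Emb (cnj \<circ> \<tau>)) (F_inf x) = snd ?O (Emb \<tau>) x"
    using O_bar_conj[OF Xs] by blast
  have O: "?O = (rclass (cartier Xs) 0, snd ?O)"
    by (metis fst_O_bar prod.collapse)
  show ?thesis
    unfolding adelic_div_def
    by (subst O, unfold mem_Collect_eq prod.case)
      (use green outside conj model0 fin in \<open>auto simp only: rclass_in[OF formal_sums_zero]\<close>)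
qed

lemma O_bar_effective:
  assumes "mult_rings Xs" "f \<in> nonneg_cont \<iota> Xs v"
  shows "ad_effective \<iota> Xs (O_bar \<iota> Xs v f)"
proof -
  have "effective_rdiv Xs (rclass (cartier Xs) 0)"
    unfolding effective_rdiv_def by (intro exI[of _ 0]) simp
  then show ?thesis using O_bar_nonneg[OF assms] by (simp add: ad_effective_def)
qed

text \<open>At \<open>v\<close> the bound comes from the hypothesis on \<open>f\<close>, at the
  conjugate place from the invariance of the Green functions of \<open>E\<close> under
  \<open>F_inf\<close>, and elsewhere from effectivity of \<open>E\<close>. Since
  \<open>O_bar\<close> has divisor zero, the difference keeps the divisor and support of
  \<open>E\<close>.\<close>

lemma O_bar_le:
  assumes Xs: "mult_rings Xs" and E: "E \<in> adelic_div \<iota> Xs" "ad_effective \<iota> Xs E"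
    and v: "v \<in> places" and f: "\<And>y. y \<in> off_supp \<iota> Xs v (fst E) \<Longrightarrow> f y \<le> snd E v y"
  shows "ad_le \<iota> Xs (O_bar \<iota> Xs v f) E"
proof -
  let ?O = "O_bar \<iota> Xs v f"
  have div: "fst E \<in> div_R Xs"
    and conj: "\<And>\<sigma> x. \<sigma> \<in> embeddings \<Longrightarrow> x \<in> an \<iota> Xs (Emb \<sigma>) \<Longrightarrow>
      snd E (Emb (cnj \<circ> \<sigma>)) (F_inf x) = snd E (Emb \<sigma>) x"
    using E(1) by (auto simp: adelic_div_def)
  have le: "snd ?O w y \<le> snd E w y" if w: "w \<in> places" and y: "y \<in> off_supp \<iota> Xs w (fst E)" for w y
  proof -
    have yan: "y \<in> an \<iota> Xs w" using y by (simp add: off_supp_def)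
    have nonneg: "snd E w y \<ge> 0" using E(2) w y by (simp add: ad_effective_def)
    show ?thesis
    proof (cases v)
      case (Fin p)
      then show ?thesis using f y nonneg by (auto simp: O_bar_Fin[OF yan])
    next
      case (Emb \<sigma>)
      have 1: "f y \<le> snd E w y" if "w = v" using f y that by simp
      have 2: "f (F_inf y) \<le> snd E w y" if wv: "w = conj_place v"
      proof -
        have w': "w = Emb (cnj \<circ> \<sigma>)" using wv Emb by simp
        have c: "Emb (cnj \<circ> (cnj \<circ> \<sigma>)) = v" using conj_conj_place[of v] Emb by simp
        have "F_inf y \<in> an \<iota> Xs v" using F_inf_an[OF Xs yan] wv by simp
        then have "F_inf y \<in> off_supp \<iota> Xs v (fst E)" using y by (simp add: off_supp_def)
        then have "f (F_inf y) \<le> snd E v (F_inf y)" by (rule f)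
        also have "\<dots> = snd E w y"
          using conj[of "cnj \<circ> \<sigma>" y] w yan unfolding c w' by (auto simp: places_def)
        finally show ?thesis .
      qed
      \<comment> \<open>At a nonreal embedding only one half of \<open>f\<close> occurs, and
        nonnegativity bounds half of the Green function by all of it.\<close>
      show ?thesis unfolding Emb O_bar_Emb[OF yan]
        using 1 2 nonneg unfolding Emb by auto
    qed
  qed
  let ?M = "ad_scale Xs (- 1) ?O"
  have fstM: "fst ?M = rclass (cartier Xs) 0" by (simp add: ad_scale_def rt_scale_zero_class)
  have fstA: "fst (ad_add \<iota> Xs E ?M) = fst E"
    by (simp add: ad_add_def Let_def fstM rt_add_zero[OF div])
  have "snd (ad_add \<iota> Xs E ?M) w y \<ge> 0" if w: "w \<in> places" and y: "y \<in> off_supp \<iota> Xs w (fst E)" for w y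
  proof -
    have "y \<in> off_supp \<iota> Xs w (fst ?M)" using y unfolding fstM by (simp add: off_supp_def)
    then have "snd (ad_add \<iota> Xs E ?M) w y = snd E w y + snd ?M w y"
      using y w by (intro snd_ad_add) (simp_all only: fstA)
    then show ?thesis using le[OF w y] by (simp add: ad_scale_def)
  qed
  then show ?thesis
    using E(2) unfolding ad_le_def ad_effective_def fstA by blast
qed


section \<open>The support of the functional\<close>

text \<open>Where both supports are avoided, the norm is the square root of
  \<open>exp_green\<close>, Green functions being normalised by the squared absolute value.
  Elsewhere the norm is a lower limit, which continuity of \<open>exp_green\<close> bounds from
  below. This also covers a point where the filter is trivial and the lower limit is
  infinite.\<close>

lemma section_norm_ge:
  assumes Xs: "mult_rings Xs" and D: "fst D \<in> div_R Xs" and s: "s \<in> rat_R" and v: "v \<in> places"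
    and x: "x \<in> an \<iota> Xs v"
    and E: "E = ad_add \<iota> Xs D (ad_principal \<iota> Xs s)"
    and cont: "continuous_map (an_top \<iota> Xs v) euclideanreal (exp_green \<iota> Xs v (fst E) (snd E v))"
  shows "ereal (sqrt (exp_green \<iota> Xs v (fst E) (snd E v) x)) \<le> section_norm \<iota> Xs D s v x"
proof -
  let ?T = "an_top \<iota> Xs v" and ?P = "principal_rdiv Xs s"
  let ?F = "exp_green \<iota> Xs v (fst E) (snd E v)"
  let ?h = "\<lambda>y. exp (log_abs y s) * exp (- snd D v y / 2)"
  define S where "S = off_supp \<iota> Xs v (fst D) \<inter> off_supp \<iota> Xs v ?P"
  have P: "?P \<in> div_R Xs" by (rule principal_rdiv_in[OF Xs s])
  have fstE: "fst E = rt_add (cartier Xs) (fst D) ?P"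
    by (simp add: E ad_add_def ad_principal_def Let_def)
  have on_S: "sqrt (?F y) = ?h y" if y: "y \<in> S" for y
  proof -
    have yE: "y \<in> off_supp \<iota> Xs v (fst E)"
      using y off_supp_add[OF Xs D P, of \<iota> v] unfolding fstE S_def by blast
    then have "snd E v y = snd D v y - 2 * log_abs y s"
      using snd_ad_add[OF v, of y \<iota> Xs D "ad_principal \<iota> Xs s"] y
      by (simp add: E S_def ad_principal_def v)
    then have "?F y = exp (log_abs y s - snd D v y / 2) ^ 2"
      using yE by (simp add: exp_green_def flip: exp_double)
    then show ?thesis by (simp flip: exp_add)
  qed
  have "ereal (sqrt (?F x)) \<le> cont_ext ?T S ?h x"
  proof (cases "x \<in> S")
    case True
    then show ?thesis by (simp add: cont_ext_def on_S)
  next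
    case False
    have "ereal (sqrt (?F x)) \<le> Liminf (atin_within ?T x S) (\<lambda>y. ereal (?h y))"
      unfolding le_Liminf_iff
    proof (intro allI impI)
      fix c assume c: "c < ereal (sqrt (?F x))"
      have "((\<lambda>y. ereal (sqrt (?F y))) \<longlongrightarrow> ereal (sqrt (?F x))) (atin ?T x)"
        using cont x unfolding continuous_map_real_iff_tendsto by (intro tendsto_intros) blast
      then have "\<forall>\<^sub>F y in atin ?T x. c < ereal (sqrt (?F y))"
        using c by (rule order_tendstoD)
      then obtain U where U: "openin ?T U" "x \<in> U" "\<forall>y\<in>U - {x}. c < ereal (sqrt (?F y))"
        using x unfolding eventually_atin by blast
      have "c < ereal (?h y)" if "y \<in> U" "y \<in> S" "y \<noteq> x" for y
        using U(3) that unfolding on_S[OF that(2), symmetric] by blast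
      then show "\<forall>\<^sub>F y in atin_within ?T x S. c < ereal (?h y)"
        unfolding eventually_atin_within using U(1,2) by blast
    qed
    with False show ?thesis by (simp add: cont_ext_def)
  qed
  then show ?thesis by (simp add: section_norm_def S_def)
qed

lemma upper_deriv_eq_zero:
  assumes Xs: "mult_rings Xs" and D: "fst D \<in> div_R Xs" and s: "s \<in> rat_R"
    and scale: "\<forall>l>0. ad_scale Xs l D \<in> C"
    and hom: "\<exists>a>0. \<forall>D\<in>C. \<forall>t>0. \<mu> (ad_scale Xs t D) = t powr a * \<mu> D"
    and inv: "\<forall>D\<in>C. \<forall>\<phi>\<in>rat_R. \<mu> (ad_add \<iota> Xs D (ad_principal \<iota> Xs \<phi>)) = \<mu> D"
    and "D \<in> C" "\<mu> D = 0"
  shows "upper_deriv \<iota> Xs \<mu> (ad_add \<iota> Xs D (ad_principal \<iota> Xs s)) D = 0"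
proof -
  let ?E = "ad_add \<iota> Xs D (ad_principal \<iota> Xs s)"
  have "\<mu> (ad_add \<iota> Xs D (ad_scale Xs e ?E)) = 0" if e: "e > 0" for e
  proof -
    have "\<mu> (ad_scale Xs (1 + e) D) = 0" using hom e assms(7,8) by fastforce
    moreover have "ad_scale Xs (1 + e) D \<in> C" using scale e by simp
    ultimately show ?thesis
      using inv rt_scale_in[OF s] unfolding ad_add_scale_principal[OF Xs D s e] by simp
  qed
  then have "\<forall>\<^sub>F e in at_right 0. ereal ((\<mu> (ad_add \<iota> Xs D (ad_scale Xs e ?E)) - \<mu> D) / e) = 0"
    using assms(8) by (intro eventually_at_rightI[of 0 1]) (auto simp: zero_ereal_def)
  then have "upper_deriv \<iota> Xs \<mu> ?E D = Limsup (at_right (0::real)) (\<lambda>e. 0)"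
    unfolding upper_deriv_def by (rule Limsup_eq)
  then show ?thesis by (simp add: Limsup_const)
qed

theorem theorem5p1p2:
  fixes \<iota> :: "'k::field_char_0 \<Rightarrow> 'f::field" and Xs :: "'f set set"
    and V C :: "('k, 'f) adiv set" and \<mu> :: "('k, 'f) adiv \<Rightarrow> real"
    and nabla :: "('k, 'f) adiv \<Rightarrow> ('k, 'f) adiv \<Rightarrow> ereal"
    and D :: "('k, 'f) adiv" and s :: "'f rrat" and v :: "'k place"
  assumes "number_field TYPE('k)"
    and "geom_integral_projective \<iota> Xs"
    and "ad_subspace \<iota> Xs V"
    and "\<forall>\<phi>\<in>rat_R. ad_principal \<iota> Xs \<phi> \<in> V"
    and "C \<subseteq> V"
    and "\<forall>D\<in>C. \<forall>l>0. ad_scale Xs l D \<in> C"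
    and "\<forall>D0\<in>C. \<forall>D\<in>V. ad_effective \<iota> Xs D \<longrightarrow>
           (\<exists>e0>0. \<forall>e. 0 \<le> e \<and> e \<le> e0 \<longrightarrow> ad_add \<iota> Xs D0 (ad_scale Xs e D) \<in> C)"
    and "\<forall>D\<in>C. \<forall>\<phi>\<in>rat_R. ad_add \<iota> Xs D (ad_principal \<iota> Xs \<phi>) \<in> C"
    and "\<exists>a>0. \<forall>D\<in>C. \<forall>t>0. \<mu> (ad_scale Xs t D) = t powr a * \<mu> D"
    and "\<forall>D\<in>C. \<forall>\<phi>\<in>rat_R. \<mu> (ad_add \<iota> Xs D (ad_principal \<iota> Xs \<phi>)) = \<mu> D"
    and "\<forall>E\<in>V. \<forall>D\<in>C. ad_effective \<iota> Xs E \<longrightarrow> nabla E D = upper_deriv \<iota> Xs \<mu> E D"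
    and "D \<in> monotone_part \<iota> Xs nabla C"
    and "\<mu> D = 0"
    and "s \<in> rat_R"
    and "ad_effective \<iota> Xs (ad_add \<iota> Xs D (ad_principal \<iota> Xs s))"
    and "v \<in> places"
  shows "Supp_Psi \<iota> Xs nabla D v \<inter> {x \<in> an \<iota> Xs v. section_norm \<iota> Xs D s v x < 1} = {}"
proof (rule ccontr)
  let ?E = "ad_add \<iota> Xs D (ad_principal \<iota> Xs s)"
  let ?F = "exp_green \<iota> Xs v (fst ?E) (snd ?E v)"
  let ?f = "\<lambda>y. 1 - ?F y"
  assume "\<not> ?thesis"
  then obtain x where x: "x \<in> an \<iota> Xs v" "section_norm \<iota> Xs D s v x < 1"
    and supp: "\<And>f. f \<in> nonneg_cont \<iota> Xs v \<Longrightarrow> f x > 0 \<Longrightarrow> Psi \<iota> Xs nabla D v f > 0"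
    by (auto simp: Supp_Psi_def)
  have Xs: "mult_rings Xs"
    using assms(2) projective_integral_mult_rings by (auto simp: geom_integral_projective_def)
  have DC: "D \<in> C" using assms(12) by (simp add: monotone_part_def)
  have DV: "D \<in> V" using DC assms(5) by blast
  have sV: "ad_principal \<iota> Xs s \<in> V" using assms(4,14) by blast
  have EV: "?E \<in> V" using assms(3) DV sV unfolding ad_subspace_def by blast
  have adelic: "V \<subseteq> adelic_div \<iota> Xs" using assms(3) unfolding ad_subspace_def by blast
  have divD: "fst D \<in> div_R Xs" using DV adelic by (auto simp: adelic_div_def)
  have green: "green \<iota> Xs v (fst ?E) (snd ?E v)"
    using subsetD[OF adelic EV] \<open>v \<in> places\<close> unfolding adelic_div_def by (auto simp: case_prod_beta)
  have eff: "effective_rdiv Xs (fst ?E)"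
    and nonneg: "\<And>w y. w \<in> places \<Longrightarrow> y \<in> off_supp \<iota> Xs w (fst ?E) \<Longrightarrow> snd ?E w y \<ge> 0"
    using assms(15) by (auto simp: ad_effective_def)
  have cont: "continuous_map (an_top \<iota> Xs v) euclideanreal ?F"
    by (rule continuous_map_exp_green[OF Xs eff green])
  \<comment> \<open>Off the support this is effectivity; on the support the extension has the value
    0.\<close>
  have "?F y \<le> 1" for y
    using nonneg[OF \<open>v \<in> places\<close>] by (simp add: exp_green_def)
  then have f: "?f \<in> nonneg_cont \<iota> Xs v"
    using cont by (auto simp: nonneg_cont_def intro!: continuous_map_diff)
  have "ereal (sqrt (?F x)) < 1"
    using section_norm_ge[OF Xs divD \<open>s \<in> rat_R\<close> \<open>v \<in> places\<close> x(1) refl cont] x(2)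
    by (rule le_less_trans)
  then have "?f x > 0" by simp
  then have pos: "nabla (O_bar \<iota> Xs v ?f) D > 0"
    using supp[OF f] by (simp add: Psi_def)
  have "?f y \<le> snd ?E v y" if "y \<in> off_supp \<iota> Xs v (fst ?E)" for y
    using exp_ge_add_one_self[of "- snd ?E v y"] that by (simp add: exp_green_def)
  then have "ad_le \<iota> Xs (O_bar \<iota> Xs v ?f) ?E"
    using subsetD[OF adelic EV] assms(15) \<open>v \<in> places\<close> by (intro O_bar_le[OF Xs])
  moreover have "O_bar \<iota> Xs v ?f \<in> adelic_div \<iota> Xs"
    by (rule O_bar_adelic[OF Xs subsetD[OF adelic EV] \<open>v \<in> places\<close> f])
  ultimately have "nabla (O_bar \<iota> Xs v ?f) D \<le> nabla ?E D"
    using assms(12,15) O_bar_effective[OF Xs f] subsetD[OF adelic EV]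
    unfolding monotone_part_def by blast
  also have "\<dots> = upper_deriv \<iota> Xs \<mu> ?E D" using assms(11,15) EV DC by blast
  also have "\<dots> = 0"
    using assms(6) DC by (intro upper_deriv_eq_zero[OF Xs divD assms(14) _ assms(9,10) DC assms(13)]) blast
  finally show False using pos by simp
qed

end
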